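(* Assume (Increments), (Waiting times) and (Integrability) as described in the context. Let $\hat{\mathbf\Pi}^0=(\hat\pi^0(t))_{t\ge0}$ be an optimal strategy for $J^0$ induced by the Bellman equation $(B_0)$ with $\gamma=0$; that is, for a solution $(\bar v^0,\bar\lambda^0)\in\mathcal{C}_b(\mathcal{S})\times\mathbb{R}$ of $(B_0)$ and an arbitrary starting position $\pi\in\mathcal{S}$, $\hat\pi^0(0-)=\pi$, at each $\tau_n$ the weights $\hat\pi^0(\tau_n)$ are a (measurably chosen) maximiser over $\pi'\in\mathcal{S}$ of $$\ln s(\hat\pi^0(\tau_n^-),\pi')-\bar\lambda^0\mathbb{E}[\eta_1]+\mathbb{E}_{R(\eta_1)}\big[\ln\langle\pi',R(\eta_1)\rangle+\bar v^0(G(\pi',R(\eta_1)))\big]$$ (the expectation being over the law of $R(\eta_1)$ only), and $\hat\pi^0(t)=G(\hat\pi^0(\tau_n),R(\tau_n,t))$ for $t\in[\tau_n,\tau_{n+1})$. Then $$\lim_{\gamma\uparrow0}\ \sup_{\pi\in\mathcal{S}}\Big|J^\gamma(\hat{\mathbf\Pi}^0,\pi)-\sup_{\mathbf\Pi\in\mathcal{A}(\pi)}J^\gamma(\mathbf\Pi,\pi)\Big|=0.$$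
   Context: Notation. $d\ge1$; $\langle x,y\rangle$ is the scalar product, $x\cdot y$ the component-wise product on $\mathbb{R}^d$; $\mathbf{1}=(1,\dots,1)$. $\mathcal{S}=\{\pi\in\mathbb{R}^d:\pi_i\ge0,\ \langle\pi,\mathbf{1}\rangle=1\}$; $\mathcal{C}_b(\mathcal{S})$ is the space of bounded continuous real functions on $\mathcal{S}$. $G(x,y):=\frac{x\cdot y}{\langle x,y\rangle}$. Transaction costs. $c_i,h_i\in[0,1)$, $i=1,\dots,d$; $p(x):=\sum_{i=1}^d\max(c_ix_i,-h_ix_i)$. For $\pi,\pi'\in\mathcal{S}$, $s(\pi,\pi')$ denotes the unique $w>0$ with $w+p(w\pi'-\pi)=1$ (ratio of wealth after to wealth before rebalancing from $\pi$ to $\pi'$ in a self-financing way). Market. $S(t)=(S_1(t),\dots,S_d(t))$, $t\ge0$, is a process of strictly positive prices, $R(t_1,t_2)=(S_i(t_2)/S_i(t_1))_{i}$, $R(t)=R(0,t)$, $r(t)=\ln R(t)$ (component-wise). $(\eta_i)_{i\ge1}$ are i.i.d. $(0,\infty)$-valued random variables, independent of the price process; $\tau_0=0$, $\tau_{n+1}=\tau_n+\eta_{n+1}$. (Increments): $t\mapsto\ln S(t)$ is right-continuous and has stationary independent increments. (Waiting times): $\mathbb{P}[\eta_i>0]=1$ and $\mathbb{E}[\eta_i]<\infty$. (Integrability): for any $\gamma<0$, $\mathbb{E}[e^{\gamma\min_i r_i(\eta_1)}]<\infty$, and $\mathbb{E}[\max_i r_i(\eta_1)]<\infty$. Entropic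 utility. $\mu^\gamma[Z]:=\frac1\gamma\ln\mathbb{E}[e^{\gamma Z}]$ for $\gamma<0$ and $\mu^0[Z]:=\mathbb{E}[Z]$. Strategies. For $\pi\in\mathcal{S}$, $\mathcal{A}(\pi)$ is the set of $\mathcal{S}$-valued weight processes $\mathbf\Pi=(\pi(t))_{t\ge0}$ with $\pi(0-)=\pi$, rebalanced only at the times $\tau_n$: at $\tau_n$ new weights $\pi(\tau_n)\in\mathcal{S}$ are chosen non-anticipatively, $\pi(t)=G(\pi(\tau_n),R(\tau_n,t))$ for $t\in[\tau_n,\tau_{n+1})$, and the pre-rebalancing weights are $\pi(\tau_{n+1}^-)=G(\pi(\tau_n),R(\tau_n,\tau_{n+1}))$, $\pi(\tau_0^-)=\pi$. Non-anticipative means: $\pi(\tau_n)$ is measurable with respect to $\mathcal{G}_n$, where $(\mathcal{G}_n)_{n\ge0}$ is a given increasing sequence of $\sigma$-fields (information at $\tau_n$) such that $\eta_1,\dots,\eta_n$ and the price path stopped at $\tau_n$ are $\mathcal{G}_n$-measurable and $((\eta_k)_{k>n},(R(\tau_n,\tau_n+t))_{t\ge0})$ is independent of $\mathcal{G}_n$. Functional. For $\gamma\le0$, $$J^\gamma(\mathbf\Pi,\pi)=\liminf_{n\to\infty}\frac1{\mathbb{E}[\tau_n]}\mu^\gamma\Big[\sum_{i=0}^{n-1}\big(\ln s(\pi(\tau_i^-),\pi(\tau_i))+\ln\langle\pi(\tau_i),R(\tau_i,\tau_{i+1})\rangle\big)\Big].$$ Bellman equation $(B_0)$: $$\bar v^0(\pi)=\sup_{\pi'\in\mathcal{S}}\Big(\ln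 s(\pi,\pi')-\bar\lambda^0\,\mathbb{E}[\eta_1]+\mathbb{E}\big[\ln\langle \pi',R(\eta_1)\rangle+\bar v^0(G(\pi',R(\eta_1)))\big]\Big),\qquad \pi\in\mathcal{S}.$$ *)

theory Defs
  imports "HOL-Probability.Probability"
begin

definition unit_simplex :: "(real ^ 'd) set" where
  "unit_simplex = {\<pi>. (\<forall>i. 0 \<le> \<pi> $ i) \<and> \<pi> \<bullet> 1 = 1}"

text \<open>The weights \<open>G(x, y) = (x \<cdot> y) / \<langle>x, y\<rangle>\<close> to which \<open>x\<close> drifts under the gross returns \<open>y\<close>.\<close>

definition drift :: "real ^ 'd \<Rightarrow> real ^ 'd \<Rightarrow> real ^ 'd" where
  "drift x y = (\<chi> i. x $ i * y $ i / (x \<bullet> y))"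


subsection \<open>Transaction costs\<close>

definition cost_rates :: "real ^ 'd \<Rightarrow> bool" where
  "cost_rates c \<longleftrightarrow> (\<forall>i. 0 \<le> c $ i \<and> c $ i < 1)"

definition cost :: "real ^ 'd \<Rightarrow> real ^ 'd \<Rightarrow> real ^ 'd \<Rightarrow> real" where
  "cost c h x = (\<Sum>i\<in>UNIV. max (c $ i * x $ i) (- h $ i * x $ i))"

definition shrink :: "real ^ 'd \<Rightarrow> real ^ 'd \<Rightarrow> real ^ 'd \<Rightarrow> real ^ 'd \<Rightarrow> real" where
  "shrink c h \<pi> \<pi>' = (THE w. 0 < w \<and> w + cost c h (w *\<^sub>R \<pi>' - \<pi>) = 1)"

text \<open>The definite description is meaningful on the simplex:\<close>

lemma shrink_ex1:
  fixes c h \<pi> \<pi>' :: "real ^ 'd"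
  assumes c: "cost_rates c" and h: "cost_rates h"
    and pi: "\<pi> \<in> unit_simplex" and pi': "\<pi>' \<in> unit_simplex"
  shows "\<exists>!w. 0 < w \<and> w + cost c h (w *\<^sub>R \<pi>' - \<pi>) = 1"
proof -
  define g where "g w = w + cost c h (w *\<^sub>R \<pi>' - \<pi>)" for w
  have rates: "0 \<le> c $ i" "c $ i < 1" "0 \<le> h $ i" "h $ i < 1" for i
    using c h by (auto simp: cost_rates_def)
  have le_sum: "(\<Sum>i\<in>UNIV. h $ i * x $ i) < 1" if x: "x \<in> unit_simplex" for x
  proof -
    have x0: "0 \<le> x $ i" for i
      using x by (simp add: unit_simplex_def)
    have x1: "(\<Sum>i\<in>UNIV. x $ i) = 1"
      using x by (simp add: unit_simplex_def inner_vec_def)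
    then obtain j where j: "x $ j \<noteq> 0"
      by (metis sum.neutral zero_neq_one)
    have "(\<Sum>i\<in>UNIV. h $ i * x $ i) < (\<Sum>i\<in>UNIV. x $ i)"
    proof (rule sum_strict_mono_ex1)
      show "\<forall>i\<in>UNIV. h $ i * x $ i \<le> x $ i"
        using rates x0 by (simp add: mult_left_le_one_le less_imp_le)
      have "h $ j * x $ j < 1 * x $ j"
        using j x0[of j] rates by (intro mult_strict_right_mono) auto
      then show "\<exists>i\<in>UNIV. h $ i * x $ i < x $ i" by auto
    qed simp
    then show ?thesis using x1 by simp
  qed
  have mono: "g a < g b" if ab: "a < b" for a b
  proof -
    have "cost c h (a *\<^sub>R \<pi>' - \<pi>) \<le>
        (\<Sum>i\<in>UNIV. max (c $ i * (b *\<^sub>R \<pi>' - \<pi>) $ i) (- h $ i * (b *\<^sub>R \<pi>' - \<pi>) $ i)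
          + (b - a) * (h $ i * \<pi>' $ i))"
      unfolding cost_def
    proof (rule sum_mono)
      fix i
      have p: "0 \<le> \<pi>' $ i" using pi' by (simp add: unit_simplex_def)
      have "c $ i * (a * \<pi>' $ i) \<le> c $ i * (b * \<pi>' $ i)"
        using p ab rates by (intro mult_left_mono mult_right_mono) auto
      moreover have "0 \<le> (b - a) * (h $ i * \<pi>' $ i)"
        using p ab rates by auto
      ultimately show "max (c $ i * (a *\<^sub>R \<pi>' - \<pi>) $ i) (- h $ i * (a *\<^sub>R \<pi>' - \<pi>) $ i)
          \<le> max (c $ i * (b *\<^sub>R \<pi>' - \<pi>) $ i) (- h $ i * (b *\<^sub>R \<pi>' - \<pi>) $ i)
          + (b - a) * (h $ i * \<pi>' $ i)"
        by (simp add: algebra_simps max_def)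
    qed
    also have "\<dots> = cost c h (b *\<^sub>R \<pi>' - \<pi>) + (b - a) * (\<Sum>i\<in>UNIV. h $ i * \<pi>' $ i)"
      by (simp add: cost_def sum.distrib sum_distrib_left)
    also have "\<dots> < cost c h (b *\<^sub>R \<pi>' - \<pi>) + (b - a) * 1"
      using le_sum[OF pi'] ab by simp
    finally show ?thesis by (simp add: g_def)
  qed
  have g0: "g 0 < 1"
  proof -
    have "max (- (c $ i * \<pi> $ i)) (h $ i * \<pi> $ i) = h $ i * \<pi> $ i" for i
    proof -
      have "0 \<le> c $ i * \<pi> $ i" "0 \<le> h $ i * \<pi> $ i"
        using pi rates by (auto simp: unit_simplex_def)
      then show ?thesis by simp
    qed
    then have "g 0 = (\<Sum>i\<in>UNIV. h $ i * \<pi> $ i)"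
      by (simp add: g_def cost_def)
    then show ?thesis using le_sum[OF pi] by simp
  qed
  have "0 \<le> max (c $ i * y) (- h $ i * y)" for i y
  proof (cases "0 \<le> y")
    case False
    then have "0 \<le> - h $ i * y" using rates by (simp add: mult_le_0_iff)
    then show ?thesis by linarith
  qed (use rates in \<open>simp add: le_max_iff_disj\<close>)
  then have g1: "1 \<le> g 1"
    unfolding g_def cost_def by (simp add: sum_nonneg)
  have "continuous_on {0..1} g"
    unfolding g_def cost_def by (intro continuous_intros)
  then obtain w where w: "0 \<le> w" "g w = 1"
    using IVT'[of g 0 1 1] g0 g1 by auto
  have "0 < w" using w g0 by (cases "w = 0") auto
  moreover have "w' = w" if "g w' = 1" for w'
    using mono[of w w'] mono[of w' w] w that by (cases w w' rule: linorder_cases) auto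
  ultimately show ?thesis
    using w unfolding g_def by blast
qed


subsection \<open>Market\<close>

text \<open>
  Time is real, but prices are only ever looked at (and restricted) at times \<open>t \<ge> 0\<close>.
  The waiting times are \<open>\<eta> 1, \<eta> 2, \<dots>\<close>; the value \<open>\<eta> 0\<close> is never used.
\<close>

definition log_price :: "(real \<Rightarrow> 'w \<Rightarrow> real ^ 'd) \<Rightarrow> real \<Rightarrow> 'w \<Rightarrow> real ^ 'd" where
  "log_price S t \<omega> = (\<chi> i. ln (S t \<omega> $ i))"

definition gross :: "(real \<Rightarrow> 'w \<Rightarrow> real ^ 'd) \<Rightarrow> real \<Rightarrow> real \<Rightarrow> 'w \<Rightarrow> real ^ 'd" where
  "gross S t1 t2 \<omega> = (\<chi> i. S t2 \<omega> $ i / S t1 \<omega> $ i)"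

definition log_return :: "(real \<Rightarrow> 'w \<Rightarrow> real ^ 'd) \<Rightarrow> real \<Rightarrow> 'w \<Rightarrow> real ^ 'd" where
  "log_return S t \<omega> = (\<chi> i. ln (gross S 0 t \<omega> $ i))"

definition tau :: "(nat \<Rightarrow> 'w \<Rightarrow> real) \<Rightarrow> nat \<Rightarrow> 'w \<Rightarrow> real" where
  "tau \<eta> n \<omega> = (\<Sum>i = 1..n. \<eta> i \<omega>)"

text \<open>
  The library's \<open>indep_var\<close> needs both random variables to have the same range type, so independence
  is stated for the generated \<open>\<sigma>\<close>-algebras.
\<close>

definition generated :: "'w measure \<Rightarrow> ('w \<Rightarrow> 'b) \<Rightarrow> 'b measure \<Rightarrow> 'w set set" where
  "generated M X N = sets (vimage_algebra (space M) X N)"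

definition market ::
  "'w measure \<Rightarrow> (real \<Rightarrow> 'w \<Rightarrow> real ^ 'd) \<Rightarrow> (nat \<Rightarrow> 'w \<Rightarrow> real) \<Rightarrow> bool" where
  "market M S \<eta> \<longleftrightarrow>
     prob_space M \<and>
     (\<forall>t\<ge>0. S t \<in> borel_measurable M) \<and>
     (\<forall>t\<ge>0. \<forall>\<omega>\<in>space M. \<forall>i. 0 < S t \<omega> $ i) \<and>
     (\<forall>i\<ge>1. \<eta> i \<in> borel_measurable M) \<and>
     (\<forall>i\<ge>1. \<forall>\<omega>\<in>space M. 0 < \<eta> i \<omega>) \<and>
     prob_space.indep_vars M (\<lambda>_. borel) \<eta> {1..} \<and>
     (\<forall>i\<ge>1. distr M borel (\<eta> i) = distr M borel (\<eta> 1)) \<and>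
     prob_space.indep_set M
       (generated M (\<lambda>\<omega>. \<lambda>i\<in>{1..}. \<eta> i \<omega>) (Pi\<^sub>M {1..} (\<lambda>_. borel)))
       (generated M (\<lambda>\<omega>. \<lambda>t\<in>{0..}. S t \<omega>) (Pi\<^sub>M {0..} (\<lambda>_. borel)))"

definition increments :: "'w measure \<Rightarrow> (real \<Rightarrow> 'w \<Rightarrow> real ^ 'd) \<Rightarrow> bool" where
  "increments M S \<longleftrightarrow>
     (\<forall>\<omega>\<in>space M. \<forall>t\<ge>0. continuous (at_right t) (\<lambda>u. log_price S u \<omega>)) \<and>
     (\<forall>a\<ge>0. \<forall>t\<ge>0.
        distr M borel (\<lambda>\<omega>. log_price S (a + t) \<omega> - log_price S a \<omega>) =
        distr M borel (\<lambda>\<omega>. log_price S t \<omega> - log_price S 0 \<omega>)) \<and>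
     (\<forall>(n::nat) t. 0 \<le> t 0 \<and> (\<forall>i<n. t i < t (Suc i)) \<longrightarrow>
        prob_space.indep_vars M (\<lambda>_. borel)
          (\<lambda>i \<omega>. log_price S (t (Suc i)) \<omega> - log_price S (t i) \<omega>) {..<n})"

definition waiting_times :: "'w measure \<Rightarrow> (nat \<Rightarrow> 'w \<Rightarrow> real) \<Rightarrow> bool" where
  "waiting_times M \<eta> \<longleftrightarrow> (\<forall>i\<ge>1. (AE \<omega> in M. 0 < \<eta> i \<omega>) \<and> integrable M (\<eta> i))"

text \<open>
  The first clause controls the negative part of \<open>max\<^sub>i r\<^sub>i(\<eta>\<^sub>1)\<close>, so that in its presence
  \<open>E[max\<^sub>i r\<^sub>i(\<eta>\<^sub>1)] < \<infinity>\<close> is the same as integrability.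
\<close>

definition integrability ::
  "'w measure \<Rightarrow> (real \<Rightarrow> 'w \<Rightarrow> real ^ 'd) \<Rightarrow> (nat \<Rightarrow> 'w \<Rightarrow> real) \<Rightarrow> bool" where
  "integrability M S \<eta> \<longleftrightarrow>
     (\<forall>\<gamma><0. integrable M (\<lambda>\<omega>. exp (\<gamma> * Min (range (\<lambda>i. log_return S (\<eta> 1 \<omega>) \<omega> $ i))))) \<and>
     integrable M (\<lambda>\<omega>. Max (range (\<lambda>i. log_return S (\<eta> 1 \<omega>) \<omega> $ i)))"


subsection \<open>Information and strategies\<close>

definition information ::
  "'w measure \<Rightarrow> (real \<Rightarrow> 'w \<Rightarrow> real ^ 'd) \<Rightarrow> (nat \<Rightarrow> 'w \<Rightarrow> real) \<Rightarrow> (nat \<Rightarrow> 'w measure) \<Rightarrow> bool" where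
  "information M S \<eta> \<G> \<longleftrightarrow>
     (\<forall>n. subalgebra M (\<G> n)) \<and>
     (\<forall>n. sets (\<G> n) \<subseteq> sets (\<G> (Suc n))) \<and>
     (\<forall>n. \<forall>k\<in>{1..n}. \<eta> k \<in> borel_measurable (\<G> n)) \<and>
     (\<forall>n. \<forall>t\<ge>0. (\<lambda>\<omega>. S (min t (tau \<eta> n \<omega>)) \<omega>) \<in> borel_measurable (\<G> n)) \<and>
     (\<forall>n. prob_space.indep_set M
        (generated M
           (\<lambda>\<omega>. (\<lambda>k\<in>{n<..}. \<eta> k \<omega>, \<lambda>t\<in>{0..}. gross S (tau \<eta> n \<omega>) (tau \<eta> n \<omega> + t) \<omega>))
           (Pi\<^sub>M {n<..} (\<lambda>_. borel) \<Otimes>\<^sub>M Pi\<^sub>M {0..} (\<lambda>_. borel)))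
        (sets (\<G> n)))"

text \<open>
  A weight process is extended to negative times by its constant initial position, which encodes
  \<open>\<pi>(0-) = \<pi>\<close>; the weights chosen at \<open>\<tau>\<^sub>n\<close> are \<open>W (\<tau>\<^sub>n)\<close>.
\<close>

definition strategies ::
  "'w measure \<Rightarrow> (real \<Rightarrow> 'w \<Rightarrow> real ^ 'd) \<Rightarrow> (nat \<Rightarrow> 'w \<Rightarrow> real) \<Rightarrow> (nat \<Rightarrow> 'w measure) \<Rightarrow>
     real ^ 'd \<Rightarrow> (real \<Rightarrow> 'w \<Rightarrow> real ^ 'd) set" where
  "strategies M S \<eta> \<G> \<pi> = {W.
     (\<forall>t. W t \<in> borel_measurable M) \<and>
     (\<forall>\<omega>\<in>space M. \<forall>t<0. W t \<omega> = \<pi>) \<and>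
     (\<forall>\<omega>\<in>space M. \<forall>t\<ge>0. W t \<omega> \<in> unit_simplex) \<and>
     (\<forall>n. (\<lambda>\<omega>. W (tau \<eta> n \<omega>) \<omega>) \<in> borel_measurable (\<G> n)) \<and>
     (\<forall>\<omega>\<in>space M. \<forall>n. \<forall>t\<in>{tau \<eta> n \<omega> ..< tau \<eta> (Suc n) \<omega>}.
        W t \<omega> = drift (W (tau \<eta> n \<omega>) \<omega>) (gross S (tau \<eta> n \<omega>) t \<omega>))}"

text \<open>The weights \<open>\<pi>(\<tau>\<^sub>n-)\<close> immediately before the rebalancing at \<open>\<tau>\<^sub>n\<close>.\<close>

definition pre_weights ::
  "(real \<Rightarrow> 'w \<Rightarrow> real ^ 'd) \<Rightarrow> (nat \<Rightarrow> 'w \<Rightarrow> real) \<Rightarrow> real ^ 'd \<Rightarrow> (real \<Rightarrow> 'w \<Rightarrow> real ^ 'd) \<Rightarrow>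
     nat \<Rightarrow> 'w \<Rightarrow> real ^ 'd" where
  "pre_weights S \<eta> \<pi> W n \<omega> =
     (case n of 0 \<Rightarrow> \<pi>
      | Suc m \<Rightarrow> drift (W (tau \<eta> m \<omega>) \<omega>) (gross S (tau \<eta> m \<omega>) (tau \<eta> (Suc m) \<omega>) \<omega>))"


subsection \<open>Entropic utility and the long-run functional\<close>

text \<open>
  For \<open>\<gamma> \<le> 0\<close>. Under \<open>integrability\<close> every expectation taken in \<open>growth\<close> is that of an
  integrable function (\<open>ln s\<close> is bounded and
  \<open>min\<^sub>i r\<^sub>i \<le> ln \<langle>\<pi>, R\<rangle> \<le> max\<^sub>i r\<^sub>i\<close>), so real values suffice.
\<close>

definition entropic :: "'w measure \<Rightarrow> real \<Rightarrow> ('w \<Rightarrow> real) \<Rightarrow> real" where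
  "entropic M \<gamma> Z =
     (if \<gamma> = 0 then (\<integral>\<omega>. Z \<omega> \<partial>M) else 1 / \<gamma> * ln (\<integral>\<omega>. exp (\<gamma> * Z \<omega>) \<partial>M))"

definition growth ::
  "'w measure \<Rightarrow> (real \<Rightarrow> 'w \<Rightarrow> real ^ 'd) \<Rightarrow> (nat \<Rightarrow> 'w \<Rightarrow> real) \<Rightarrow> real ^ 'd \<Rightarrow> real ^ 'd \<Rightarrow>
     real \<Rightarrow> (real \<Rightarrow> 'w \<Rightarrow> real ^ 'd) \<Rightarrow> real ^ 'd \<Rightarrow> ereal" where
  "growth M S \<eta> c h \<gamma> W \<pi> = liminf (\<lambda>n. ereal
     (1 / (\<integral>\<omega>. tau \<eta> n \<omega> \<partial>M) *
      entropic M \<gamma> (\<lambda>\<omega>. \<Sum>i<n.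
        ln (shrink c h (pre_weights S \<eta> \<pi> W i \<omega>) (W (tau \<eta> i \<omega>) \<omega>)) +
        ln (W (tau \<eta> i \<omega>) \<omega> \<bullet> gross S (tau \<eta> i \<omega>) (tau \<eta> (Suc i) \<omega>) \<omega>))))"


subsection \<open>Bellman equation for \<open>\<gamma> = 0\<close>\<close>

definition bellman_term ::
  "'w measure \<Rightarrow> (real \<Rightarrow> 'w \<Rightarrow> real ^ 'd) \<Rightarrow> (nat \<Rightarrow> 'w \<Rightarrow> real) \<Rightarrow> real ^ 'd \<Rightarrow> real ^ 'd \<Rightarrow>
     (real ^ 'd \<Rightarrow> real) \<Rightarrow> real \<Rightarrow> real ^ 'd \<Rightarrow> real ^ 'd \<Rightarrow> real" where
  "bellman_term M S \<eta> c h v l \<pi> \<pi>' =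
     ln (shrink c h \<pi> \<pi>') - l * (\<integral>\<omega>. \<eta> 1 \<omega> \<partial>M) +
     (\<integral>\<omega>. ln (\<pi>' \<bullet> gross S 0 (\<eta> 1 \<omega>) \<omega>) + v (drift \<pi>' (gross S 0 (\<eta> 1 \<omega>) \<omega>)) \<partial>M)"

text \<open>The supremum is taken in \<open>ereal\<close>, where it is one without a boundedness proviso.\<close>

definition bellman_solution ::
  "'w measure \<Rightarrow> (real \<Rightarrow> 'w \<Rightarrow> real ^ 'd) \<Rightarrow> (nat \<Rightarrow> 'w \<Rightarrow> real) \<Rightarrow> real ^ 'd \<Rightarrow> real ^ 'd \<Rightarrow>
     (real ^ 'd \<Rightarrow> real) \<Rightarrow> real \<Rightarrow> bool" where
  "bellman_solution M S \<eta> c h v l \<longleftrightarrow>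
     continuous_on unit_simplex v \<and> bounded (v ` unit_simplex) \<and>
     (\<forall>\<pi>\<in>unit_simplex.
        ereal (v \<pi>) = (SUP \<pi>'\<in>unit_simplex. ereal (bellman_term M S \<eta> c h v l \<pi> \<pi>')))"

text \<open>
  The maximisers are chosen measurably in the sense that the resulting process is a strategy, i.e.
  the weights picked at \<open>\<tau>\<^sub>n\<close> are \<open>\<G> n\<close>-measurable; they need not come from one fixed selector.
\<close>

definition bellman_strategy ::
  "'w measure \<Rightarrow> (real \<Rightarrow> 'w \<Rightarrow> real ^ 'd) \<Rightarrow> (nat \<Rightarrow> 'w \<Rightarrow> real) \<Rightarrow> (nat \<Rightarrow> 'w measure) \<Rightarrow>
     real ^ 'd \<Rightarrow> real ^ 'd \<Rightarrow> (real ^ 'd \<Rightarrow> real) \<Rightarrow> real \<Rightarrow> real ^ 'd \<Rightarrow>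
     (real \<Rightarrow> 'w \<Rightarrow> real ^ 'd) \<Rightarrow> bool" where
  "bellman_strategy M S \<eta> \<G> c h v l \<pi> W \<longleftrightarrow>
     W \<in> strategies M S \<eta> \<G> \<pi> \<and>
     (\<forall>n. \<forall>\<omega>\<in>space M.
        is_arg_max (bellman_term M S \<eta> c h v l (pre_weights S \<eta> \<pi> W n \<omega>))
          (\<lambda>\<pi>'. \<pi>' \<in> unit_simplex) (W (tau \<eta> n \<omega>) \<omega>))"

end

theory Submission
  imports Defs
begin

text \<open>
  The strategy induced by the risk-neutral Bellman equation is nearly optimal for small risk aversion
  because, uniformly over starting positions, its growth rate differs by \<open>o(1)\<close> from an upper
  bound that holds for every strategy and every \<open>\<gamma> < 0\<close>.

  Let \<open>m\<close> be the mean waiting time. For weights \<open>w\<close> held over a period with gross returns \<open>y\<close>, call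
  \<open>ln \<langle>w, y\<rangle> + v (drift w y)\<close> the reward and its deviation from the mean the surprise. The Bellman
  equation telescopes (\<open>log_wealth_telescope\<close>): up to a boundary term \<open>2 * sup \<bar>v\<bar>\<close>, the log wealth
  after \<open>n\<close> periods is at most \<open>n * l * m\<close> plus the sum of the surprises, with equality, again up to
  the boundary term, when the weights are chosen as maximisers.

  At the rebalancing time \<open>\<tau>\<^sub>n\<close> the coming gross return is independent of the past and has the same law
  for every \<open>n\<close> (\<open>period_indep\<close>, \<open>period_law\<close>). The surprises are therefore centred given the past, and
  each has a conditional exponential moment between \<open>1\<close> and \<open>1 + risk \<gamma>\<close> (\<open>exp_surprise\<close>).
  Multiplying these bounds over the periods (\<open>adapted_product_bounds\<close>) shows that every strategy
  grows at rate at most \<open>l\<close> (\<open>growth_le\<close>), whereas the Bellman strategy grows at rate at least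
  \<open>l - risk \<gamma> / (\<bar>\<gamma>\<bar> * m)\<close> (\<open>growth_bellman_ge\<close>). Finally \<open>risk \<gamma> / \<gamma>\<close> tends to zero
  (\<open>risk_div_tendsto\<close>), although the log returns need not be square integrable.
\<close>

section \<open>Weights, drift and log returns\<close>

lemma unit_simplexD:
  assumes "x \<in> unit_simplex"
  shows "0 \<le> x $ i" and "(\<Sum>i\<in>UNIV. x $ i) = 1"
  using assms by (auto simp: unit_simplex_def inner_vec_def)

lemma unit_simplex_nonempty: "unit_simplex \<noteq> ({} :: (real ^ 'd) set)"
proof -
  have "axis undefined 1 \<in> (unit_simplex :: (real ^ 'd) set)"
    by (simp add: unit_simplex_def inner_axis') (simp add: axis_def)
  then show ?thesis by blast
qed

lemma closed_unit_simplex: "closed (unit_simplex :: (real ^ 'd) set)"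
proof -
  have eq: "unit_simplex = (\<Inter>i. {x :: real ^ 'd. 0 \<le> x $ i}) \<inter> {x. x \<bullet> 1 = 1}"
    by (auto simp: unit_simplex_def)
  show ?thesis
    unfolding eq
    by (intro closed_Int closed_INT ballI closed_Collect_le closed_Collect_eq continuous_intros)
qed

lemma inner_simplex_bounds:
  fixes w y :: "real ^ 'd"
  assumes w: "w \<in> unit_simplex"
  shows "Min (range (\<lambda>i. y $ i)) \<le> w \<bullet> y" and "w \<bullet> y \<le> Max (range (\<lambda>i. y $ i))"
proof -
  have "(\<Sum>i\<in>UNIV. w $ i * Min (range (\<lambda>i. y $ i))) \<le> (\<Sum>i\<in>UNIV. w $ i * y $ i)"
    using unit_simplexD[OF w] by (intro sum_mono mult_left_mono) auto
  then show "Min (range (\<lambda>i. y $ i)) \<le> w \<bullet> y"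
    by (simp add: inner_vec_def unit_simplexD(2)[OF w] flip: sum_distrib_right)
  have "(\<Sum>i\<in>UNIV. w $ i * y $ i) \<le> (\<Sum>i\<in>UNIV. w $ i * Max (range (\<lambda>i. y $ i)))"
    using unit_simplexD[OF w] by (intro sum_mono mult_left_mono) auto
  then show "w \<bullet> y \<le> Max (range (\<lambda>i. y $ i))"
    by (simp add: inner_vec_def unit_simplexD(2)[OF w] flip: sum_distrib_right)
qed

lemma inner_simplex_pos:
  fixes w y :: "real ^ 'd"
  assumes "w \<in> unit_simplex" and "\<And>i. 0 < y $ i"
  shows "0 < w \<bullet> y"
proof -
  have "0 < Min (range (\<lambda>i. y $ i))" using assms(2) by (subst Min_gr_iff) auto
  then show ?thesis using inner_simplex_bounds(1)[OF assms(1), of y] by linarith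
qed

lemma drift_simplex:
  fixes w y :: "real ^ 'd"
  assumes w: "w \<in> unit_simplex" and y: "\<And>i. 0 < y $ i"
  shows "drift w y \<in> unit_simplex"
proof -
  have pos: "0 < w \<bullet> y" using inner_simplex_pos[OF w] y by blast
  have "(\<Sum>i\<in>UNIV. w $ i * y $ i / (w \<bullet> y)) = (\<Sum>i\<in>UNIV. w $ i * y $ i) / (w \<bullet> y)"
    by (simp add: sum_divide_distrib)
  also have "\<dots> = 1" using pos by (simp add: inner_vec_def)
  finally show ?thesis
    using pos unit_simplexD(1)[OF w] y
    by (auto simp: unit_simplex_def drift_def inner_vec_def[of _ 1] less_imp_le)
qed

definition log_min :: "real ^ 'd \<Rightarrow> real" where
  "log_min y = Min (range (\<lambda>i. ln (y $ i)))"

definition log_max :: "real ^ 'd \<Rightarrow> real" where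
  "log_max y = Max (range (\<lambda>i. ln (y $ i)))"

lemma log_min_le_log_max: "log_min y \<le> log_max (y :: real ^ 'd)"
proof -
  have "log_min y \<le> ln (y $ undefined)" "ln (y $ undefined) \<le> log_max y"
    by (auto simp: log_min_def log_max_def)
  then show ?thesis by linarith
qed

lemma ln_inner_simplex_bounds:
  fixes w y :: "real ^ 'd"
  assumes w: "w \<in> unit_simplex" and y: "\<And>i. 0 < y $ i"
  shows "log_min y \<le> ln (w \<bullet> y)" and "ln (w \<bullet> y) \<le> log_max y"
proof -
  have "Min (range (\<lambda>i. y $ i)) \<in> range (\<lambda>i. y $ i)" by (intro Min_in) auto
  then obtain i where i: "Min (range (\<lambda>i. y $ i)) = y $ i" by (metis imageE)
  have "log_min y \<le> ln (y $ i)" by (auto simp: log_min_def)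
  also have "\<dots> \<le> ln (w \<bullet> y)"
    using inner_simplex_bounds(1)[OF w, of y] y inner_simplex_pos[OF w y] by (simp add: i)
  finally show "log_min y \<le> ln (w \<bullet> y)" .
  have "Max (range (\<lambda>i. y $ i)) \<in> range (\<lambda>i. y $ i)" by (intro Max_in) auto
  then obtain i where i: "Max (range (\<lambda>i. y $ i)) = y $ i" by (metis imageE)
  have "ln (w \<bullet> y) \<le> ln (y $ i)"
    using inner_simplex_bounds(2)[OF w, of y] y inner_simplex_pos[OF w y] by (simp add: i)
  also have "\<dots> \<le> log_max y" by (auto simp: log_max_def)
  finally show "ln (w \<bullet> y) \<le> log_max y" .
qed

lemma measurable_vec_nth [measurable]:
  "f \<in> borel_measurable M \<Longrightarrow> (\<lambda>x. f x $ i) \<in> borel_measurable M" for f :: "_ \<Rightarrow> real ^ 'd"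
  by (erule borel_measurable_continuous_on[rotated]) (intro continuous_intros)

lemma measurable_vec_lambda:
  fixes f :: "'a \<Rightarrow> real ^ 'd"
  assumes "\<And>i. (\<lambda>x. f x $ i) \<in> borel_measurable M"
  shows "f \<in> borel_measurable M"
  using assms
  by (auto simp: borel_measurable_euclidean_space[of f] Basis_vec_def inner_axis)

lemma measurable_drift [measurable]:
  fixes f g :: "'a \<Rightarrow> real ^ 'd"
  assumes [measurable]: "f \<in> borel_measurable M" "g \<in> borel_measurable M"
  shows "(\<lambda>x. drift (f x) (g x)) \<in> borel_measurable M"
  by (rule measurable_vec_lambda) (simp add: drift_def)

lemma measurable_log_min [measurable]: "log_min \<in> borel_measurable (borel :: (real ^ 'd) measure)"
  unfolding log_min_def[abs_def] by (intro borel_measurable_Min) auto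

lemma measurable_log_max [measurable]: "log_max \<in> borel_measurable (borel :: (real ^ 'd) measure)"
  unfolding log_max_def[abs_def] by (intro borel_measurable_Max) auto

section \<open>The wealth ratio\<close>

lemma shrink_eq:
  assumes "cost_rates c" "cost_rates h" "\<pi> \<in> unit_simplex" "\<pi>' \<in> unit_simplex"
  shows "0 < shrink c h \<pi> \<pi>'"
    and "shrink c h \<pi> \<pi>' + cost c h (shrink c h \<pi> \<pi>' *\<^sub>R \<pi>' - \<pi>) = 1"
  using theI'[OF shrink_ex1[OF assms]] by (auto simp: shrink_def)

definition max_rate :: "real ^ 'd \<Rightarrow> real" where
  "max_rate h = Max (range (\<lambda>i. h $ i))"

lemma max_rate:
  assumes "cost_rates (h :: real ^ 'd)"
  shows "h $ i \<le> max_rate h" "max_rate h < 1"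
  using assms by (auto simp: max_rate_def cost_rates_def)

lemma sum_max_rate:
  assumes "cost_rates (h :: real ^ 'd)" "x \<in> unit_simplex"
  shows "(\<Sum>i\<in>UNIV. h $ i * x $ i) \<le> max_rate h"
proof -
  have "(\<Sum>i\<in>UNIV. h $ i * x $ i) \<le> (\<Sum>i\<in>UNIV. max_rate h * x $ i)"
    using max_rate[OF assms(1)] unit_simplexD[OF assms(2)] by (intro sum_mono mult_right_mono) auto
  then show ?thesis by (simp add: unit_simplexD[OF assms(2)] flip: sum_distrib_left)
qed

text \<open>
  The only part of the cost that falls when \<open>w\<close> grows is the cost of selling, and per unit of \<open>w\<close> it
  falls by at most the average \<open>\<Sum>i. h i * \<pi>' i\<close>, which is below one. So the budget grows strictly.
\<close>

lemma budget_strict_mono: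
  assumes c: "cost_rates c" and h: "cost_rates (h :: real ^ 'd)" and p: "\<pi>' \<in> unit_simplex"
    and ab: "a < b"
  shows "a + cost c h (a *\<^sub>R \<pi>' - \<pi>) < b + cost c h (b *\<^sub>R \<pi>' - \<pi>)"
proof -
  have "cost c h (a *\<^sub>R \<pi>' - \<pi>) \<le> (\<Sum>i\<in>UNIV.
      max (c $ i * (b *\<^sub>R \<pi>' - \<pi>) $ i) (- h $ i * (b *\<^sub>R \<pi>' - \<pi>) $ i)
      + (b - a) * (h $ i * \<pi>' $ i))"
    unfolding cost_def
  proof (rule sum_mono)
    fix i
    have r: "0 \<le> c $ i" "0 \<le> h $ i" "0 \<le> \<pi>' $ i"
      using c h unit_simplexD(1)[OF p] by (auto simp: cost_rates_def)
    have "c $ i * (a * \<pi>' $ i) \<le> c $ i * (b * \<pi>' $ i)"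
      using r ab by (intro mult_left_mono mult_right_mono) auto
    moreover have "0 \<le> (b - a) * (h $ i * \<pi>' $ i)" using r ab by auto
    ultimately show "max (c $ i * (a *\<^sub>R \<pi>' - \<pi>) $ i) (- h $ i * (a *\<^sub>R \<pi>' - \<pi>) $ i)
        \<le> max (c $ i * (b *\<^sub>R \<pi>' - \<pi>) $ i) (- h $ i * (b *\<^sub>R \<pi>' - \<pi>) $ i)
          + (b - a) * (h $ i * \<pi>' $ i)"
      by (simp add: algebra_simps max_def)
  qed
  also have "\<dots> = cost c h (b *\<^sub>R \<pi>' - \<pi>) + (b - a) * (\<Sum>i\<in>UNIV. h $ i * \<pi>' $ i)"
    by (simp add: cost_def sum.distrib sum_distrib_left)
  also have "\<dots> < cost c h (b *\<^sub>R \<pi>' - \<pi>) + (b - a) * 1"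
    using sum_max_rate[OF h p] max_rate[OF h] ab by auto
  finally show ?thesis by simp
qed

text \<open>
  The wealth ratio is a definite description, whose dependence on the weights is hidden. Monotonicity of
  the budget expresses its sublevel sets by an explicit inequality; Borel measurability follows from
  this without any appeal to an implicit function theorem.
\<close>

lemma shrink_le_iff:
  assumes c: "cost_rates c" and h: "cost_rates (h :: real ^ 'd)"
    and p: "\<pi> \<in> unit_simplex" and p': "\<pi>' \<in> unit_simplex"
  shows "shrink c h \<pi> \<pi>' \<le> a \<longleftrightarrow> 1 \<le> a + cost c h (a *\<^sub>R \<pi>' - \<pi>)"
  using shrink_eq(2)[OF assms] budget_strict_mono[OF c h p', of a "shrink c h \<pi> \<pi>'" \<pi>]
    budget_strict_mono[OF c h p', of "shrink c h \<pi> \<pi>'" a \<pi>]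
  by (cases a "shrink c h \<pi> \<pi>'" rule: linorder_cases) auto

lemma measurable_shrink:
  fixes P Q :: "'a \<Rightarrow> real ^ 'd"
  assumes c: "cost_rates c" and h: "cost_rates h"
    and [measurable]: "P \<in> borel_measurable M" "Q \<in> borel_measurable M"
    and P: "\<And>x. x \<in> space M \<Longrightarrow> P x \<in> unit_simplex"
    and Q: "\<And>x. x \<in> space M \<Longrightarrow> Q x \<in> unit_simplex"
  shows "(\<lambda>x. shrink c h (P x) (Q x)) \<in> borel_measurable M"
  unfolding borel_measurable_iff_le
proof
  fix a :: real
  have "{x \<in> space M. shrink c h (P x) (Q x) \<le> a} =
      {x \<in> space M. 1 \<le> a + cost c h (a *\<^sub>R Q x - P x)}"
    using shrink_le_iff[OF c h P Q] by auto
  also have "\<dots> \<in> sets M"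
    unfolding cost_def by measurable
  finally show "{x \<in> space M. shrink c h (P x) (Q x) \<le> a} \<in> sets M" .
qed

text \<open>
  The logarithm of the wealth ratio is thus bounded below uniformly in the weights, which is what makes
  exponential moments of the accumulated log wealth finite for every strategy.
\<close>

lemma shrink_lower_bound:
  assumes c: "cost_rates c" and h: "cost_rates (h :: real ^ 'd)"
    and p: "\<pi> \<in> unit_simplex" and p': "\<pi>' \<in> unit_simplex"
  shows "(1 - max_rate h) / 2 \<le> shrink c h \<pi> \<pi>'"
proof -
  define w where "w = shrink c h \<pi> \<pi>'"
  have w: "0 < w" "w + cost c h (w *\<^sub>R \<pi>' - \<pi>) = 1"
    using shrink_eq[OF assms] by (auto simp: w_def)
  have "cost c h (w *\<^sub>R \<pi>' - \<pi>) \<le> (\<Sum>i\<in>UNIV. w * \<pi>' $ i + h $ i * \<pi> $ i)"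
    unfolding cost_def
  proof (rule sum_mono)
    fix i
    have r: "0 \<le> c $ i" "c $ i \<le> 1" "0 \<le> h $ i" "0 \<le> w * \<pi>' $ i" "0 \<le> \<pi> $ i"
      using c h w(1) unit_simplexD(1)[OF p] unit_simplexD(1)[OF p']
      by (auto simp: cost_rates_def less_imp_le)
    have "c $ i * (w * \<pi>' $ i) \<le> w * \<pi>' $ i" "0 \<le> c $ i * \<pi> $ i" "0 \<le> h $ i * \<pi> $ i"
      "0 \<le> h $ i * (w * \<pi>' $ i)"
      using r by (auto simp: mult_left_le_one_le)
    then show "max (c $ i * (w *\<^sub>R \<pi>' - \<pi>) $ i) (- h $ i * (w *\<^sub>R \<pi>' - \<pi>) $ i)
        \<le> w * \<pi>' $ i + h $ i * \<pi> $ i"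
      using r by (simp only: vector_minus_component vector_scaleR_component real_scaleR_def
          right_diff_distrib max.bounded_iff mult_minus_left) linarith
  qed
  also have "\<dots> = w + (\<Sum>i\<in>UNIV. h $ i * \<pi> $ i)"
    by (simp add: sum.distrib unit_simplexD(2)[OF p'] flip: sum_distrib_left)
  also have "\<dots> \<le> w + max_rate h" using sum_max_rate[OF h p] by simp
  finally have "1 - max_rate h \<le> 2 * w" using w by simp
  then show ?thesis unfolding w_def by simp
qed


section \<open>Sampling right-continuous paths at random times\<close>

text \<open>
  Grid points strictly to the right of \<open>t\<close>: along them right-continuity gives convergence, and at each
  level \<open>k\<close> only countably many of them occur.
\<close>

definition grid_above :: "nat \<Rightarrow> real \<Rightarrow> real" where
  "grid_above k t = real (Suc (nat \<lfloor>real (Suc k) * t\<rfloor>)) / real (Suc k)"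

lemma grid_above_bounds:
  assumes "0 \<le> t"
  shows "t < grid_above k t" "grid_above k t \<le> t + 1 / real (Suc k)"
proof -
  have n: "real (nat \<lfloor>real (Suc k) * t\<rfloor>) = of_int \<lfloor>real (Suc k) * t\<rfloor>"
    using assms by simp
  have "real (Suc k) * t < real (Suc (nat \<lfloor>real (Suc k) * t\<rfloor>))"
    using n by linarith
  then show "t < grid_above k t"
    by (simp add: grid_above_def field_simps del: of_nat_Suc)
  have "real (Suc (nat \<lfloor>real (Suc k) * t\<rfloor>)) \<le> real (Suc k) * t + 1"
    using n by linarith
  then have "grid_above k t \<le> (real (Suc k) * t + 1) / real (Suc k)"
    unfolding grid_above_def by (intro divide_right_mono) auto
  also have "\<dots> = t + 1 / real (Suc k)" by (simp add: field_simps)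
  finally show "grid_above k t \<le> t + 1 / real (Suc k)" .
qed

lemma grid_above_tendsto:
  assumes "0 \<le> t"
  shows "filterlim (\<lambda>k. grid_above k t) (at_right t) sequentially"
  unfolding filterlim_at
proof
  have "(\<lambda>k. t + 1 / real (Suc k)) \<longlonglongrightarrow> t + 0"
    by (intro tendsto_add tendsto_const LIMSEQ_Suc lim_1_over_n)
  then have lim: "(\<lambda>k. t + 1 / real (Suc k)) \<longlonglongrightarrow> t" by simp
  show "(\<lambda>k. grid_above k t) \<longlonglongrightarrow> t"
  proof (rule tendsto_sandwich[OF _ _ tendsto_const lim])
    show "\<forall>\<^sub>F k in sequentially. t \<le> grid_above k t"
      by (intro always_eventually allI less_imp_le grid_above_bounds assms)
    show "\<forall>\<^sub>F k in sequentially. grid_above k t \<le> t + 1 / real (Suc k)"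
      by (intro always_eventually allI grid_above_bounds assms)
  qed
  show "\<forall>\<^sub>F k in sequentially. grid_above k t \<in> {t<..} \<and> grid_above k t \<noteq> t"
  proof (intro always_eventually allI)
    fix k
    show "grid_above k t \<in> {t<..} \<and> grid_above k t \<noteq> t"
      using grid_above_bounds(1)[OF assms, of k] by simp
  qed
qed

text \<open>
  On the product \<open>\<sigma>\<close>-algebra of all paths, evaluation at a variable time is not measurable. The limit
  along the grid is measurable jointly in time and path, and it agrees with evaluation on
  right-continuous paths. This turns statements about whole price paths into statements about prices at
  random times.
\<close>

definition right_eval :: "real \<Rightarrow> (real \<Rightarrow> real ^ 'd) \<Rightarrow> real ^ 'd" where
  "right_eval t p = lim (\<lambda>k. p (grid_above k t))"

lemma right_eval_eq:
  assumes "0 \<le> t" and p: "continuous (at_right t) p"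
  shows "right_eval t (restrict p {0..}) = p t"
proof -
  have "(\<lambda>k. p (grid_above k t)) \<longlonglongrightarrow> p t"
    using filterlim_compose[OF _ grid_above_tendsto[OF assms(1)]] p
    by (auto simp: continuous_within)
  moreover have "restrict p {0..} (grid_above k t) = p (grid_above k t)" for k
    using grid_above_bounds(1)[OF assms(1), of k] assms(1) by auto
  ultimately show ?thesis
    by (simp add: right_eval_def limI)
qed

lemma measurable_right_eval:
  "(\<lambda>(t, p). right_eval t p) \<in>
    borel \<Otimes>\<^sub>M Pi\<^sub>M {0..} (\<lambda>_. borel) \<rightarrow>\<^sub>M (borel :: (real ^ 'd) measure)"
proof -
  have "(\<lambda>x. snd x (grid_above k (fst x))) \<in>
      borel \<Otimes>\<^sub>M Pi\<^sub>M {0..} (\<lambda>_. borel) \<rightarrow>\<^sub>M (borel :: (real ^ 'd) measure)" for k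
    unfolding grid_above_def
  proof (rule measurable_compose_countable[where g="\<lambda>x. nat \<lfloor>real (Suc k) * fst x\<rfloor>"
        and f="\<lambda>n x. snd x (real (Suc n) / real (Suc k))"])
    fix n :: nat
    have "real (Suc n) / real (Suc k) \<in> {0..}" by auto
    from measurable_component_singleton[OF this]
    show "(\<lambda>x. snd x (real (Suc n) / real (Suc k))) \<in>
      borel \<Otimes>\<^sub>M Pi\<^sub>M {0..} (\<lambda>_. borel) \<rightarrow>\<^sub>M (borel :: (real ^ 'd) measure)"
      by (rule measurable_compose[OF measurable_snd])
    show "(\<lambda>x. nat \<lfloor>real (Suc k) * fst x\<rfloor>) \<in>
        borel \<Otimes>\<^sub>M Pi\<^sub>M {0..} (\<lambda>_. borel :: (real ^ 'd) measure) \<rightarrow>\<^sub>M count_space UNIV"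
      by measurable
  qed
  then show ?thesis
    unfolding right_eval_def split_beta' by (rule borel_measurable_lim_metric)
qed

lemma measurable_right_eval_compose:
  fixes q :: "'a \<Rightarrow> real \<Rightarrow> real ^ 'd"
  assumes "f \<in> borel_measurable N" and "q \<in> N \<rightarrow>\<^sub>M Pi\<^sub>M {0..} (\<lambda>_. borel)"
  shows "(\<lambda>x. right_eval (f x) (q x)) \<in> borel_measurable N"
  using measurable_compose[OF measurable_Pair[OF assms] measurable_right_eval]
  by (simp only: prod.case)

section \<open>Independence as a product law\<close>

text \<open>
  Independence is assumed event by event because it will be applied to random elements with different
  range types, such as the waiting times and the price path.
\<close>

lemma (in prob_space) indep_nn_integral:
  assumes X [measurable]: "X \<in> M \<rightarrow>\<^sub>M N1" and Y [measurable]: "Y \<in> M \<rightarrow>\<^sub>M N2"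
    and indep: "\<And>A B. A \<in> sets N1 \<Longrightarrow> B \<in> sets N2 \<Longrightarrow>
      prob ((X -` A \<inter> space M) \<inter> (Y -` B \<inter> space M)) =
      prob (X -` A \<inter> space M) * prob (Y -` B \<inter> space M)"
    and f [measurable]: "f \<in> borel_measurable (N1 \<Otimes>\<^sub>M N2)"
  shows "(\<integral>\<^sup>+\<omega>. f (X \<omega>, Y \<omega>) \<partial>M) = (\<integral>\<^sup>+\<omega>. \<integral>\<^sup>+y. f (X \<omega>, y) \<partial>distr M N2 Y \<partial>M)"
proof -
  interpret X: prob_space "distr M N1 X" by (rule prob_space_distr) fact
  interpret Y: prob_space "distr M N2 Y" by (rule prob_space_distr) fact
  have law: "distr M N1 X \<Otimes>\<^sub>M distr M N2 Y = distr M (N1 \<Otimes>\<^sub>M N2) (\<lambda>\<omega>. (X \<omega>, Y \<omega>))"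
  proof (rule pair_measure_eqI)
    show "sigma_finite_measure (distr M N1 X)" "sigma_finite_measure (distr M N2 Y)"
      by unfold_locales
    show "sets (distr M N1 X \<Otimes>\<^sub>M distr M N2 Y) =
        sets (distr M (N1 \<Otimes>\<^sub>M N2) (\<lambda>\<omega>. (X \<omega>, Y \<omega>)))"
      by (simp cong: sets_pair_measure_cong)
    fix A B assume "A \<in> sets (distr M N1 X)" "B \<in> sets (distr M N2 Y)"
    then have A [measurable]: "A \<in> sets N1" and B [measurable]: "B \<in> sets N2" by auto
    have eq: "(\<lambda>\<omega>. (X \<omega>, Y \<omega>)) -` (A \<times> B) \<inter> space M =
        (X -` A \<inter> space M) \<inter> (Y -` B \<inter> space M)"
      by auto
    show "emeasure (distr M N1 X) A * emeasure (distr M N2 Y) B =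
        emeasure (distr M (N1 \<Otimes>\<^sub>M N2) (\<lambda>\<omega>. (X \<omega>, Y \<omega>))) (A \<times> B)"
      using indep[OF A B]
      by (simp add: emeasure_distr eq emeasure_eq_measure ennreal_mult')
  qed
  have f12: "f \<in> borel_measurable (distr M N1 X \<Otimes>\<^sub>M distr M N2 Y)"
    and f2: "f \<in> borel_measurable (N1 \<Otimes>\<^sub>M distr M N2 Y)"
    by (subst measurable_cong_sets[OF sets_pair_measure_cong refl], rule_tac [3] f; simp)+
  have "(\<integral>\<^sup>+\<omega>. f (X \<omega>, Y \<omega>) \<partial>M) = (\<integral>\<^sup>+z. f z \<partial>distr M (N1 \<Otimes>\<^sub>M N2) (\<lambda>\<omega>. (X \<omega>, Y \<omega>)))"
    by (subst nn_integral_distr) simp_all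
  also have "\<dots> = (\<integral>\<^sup>+x. \<integral>\<^sup>+y. f (x, y) \<partial>distr M N2 Y \<partial>distr M N1 X)"
    by (simp add: law[symmetric] Y.nn_integral_fst[OF f12])
  also have "\<dots> = (\<integral>\<^sup>+\<omega>. \<integral>\<^sup>+y. f (X \<omega>, y) \<partial>distr M N2 Y \<partial>M)"
    by (rule nn_integral_distr[OF X]) (simp add: Y.borel_measurable_nn_integral_fst[OF f2])
  finally show ?thesis .
qed


section \<open>The remainder of the exponential\<close>

text \<open>
  The second-order remainder of the exponential at zero: for a centred random variable \<open>X\<close>,
  \<open>E[exp (\<gamma> X)] = 1 + E[excess (\<gamma> X)]\<close>.
\<close>

definition excess :: "real \<Rightarrow> real" where
  "excess x = exp x - 1 - x"

lemma le_exp_minus_one: "x \<le> exp x - 1" for x :: real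
  using exp_ge_add_one_self[of x] by (simp only: le_diff_eq add.commute)

lemma excess_nonneg: "0 \<le> excess x"
  using le_exp_minus_one[of x] by (simp add: excess_def)

lemma excess_mono:
  assumes "0 \<le> a" "a \<le> b"
  shows "excess a \<le> excess b"
proof -
  have "b - a \<le> exp (b - a) - 1" by (rule le_exp_minus_one)
  also have "\<dots> = 1 * (exp (b - a) - 1)" by simp
  also have "\<dots> \<le> exp a * (exp (b - a) - 1)" using assms by (intro mult_right_mono) auto
  also have "\<dots> = exp b - exp a" by (simp add: right_diff_distrib flip: exp_add)
  finally show ?thesis by (simp add: excess_def)
qed

lemma excess_antimono:
  assumes "b \<le> a" "a \<le> 0"
  shows "excess a \<le> excess b"
proof -
  have "exp a - exp b = exp a * (1 - exp (b - a))" by (simp add: right_diff_distrib flip: exp_add)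
  also have "\<dots> \<le> 1 * (1 - exp (b - a))" using assms by (intro mult_right_mono) auto
  also have "\<dots> = - (exp (b - a) - 1)" by simp
  also have "\<dots> \<le> - (b - a)" by (intro le_imp_neg_le le_exp_minus_one)
  finally show ?thesis by (simp add: excess_def)
qed

text \<open>
  For \<open>\<gamma> \<le> 0\<close> the remainder has to be controlled separately on gains and on losses, because gains are
  only known to have a first moment whereas losses have exponential moments.
\<close>

lemma excess_interval:
  assumes "-L \<le> x" "x \<le> U" "0 \<le> L" "0 \<le> U" "\<gamma> \<le> 0"
  shows "excess (\<gamma> * x) \<le> excess (\<gamma> * U) + excess (- \<gamma> * L)"
proof (cases "0 \<le> x")
  case True
  then have "excess (\<gamma> * x) \<le> excess (\<gamma> * U)"
    using assms by (intro excess_antimono mult_left_mono_neg mult_nonpos_nonneg) auto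
  then show ?thesis using excess_nonneg[of "- \<gamma> * L"] by linarith
next
  case False
  have "\<gamma> * x \<le> \<gamma> * (- L)" using assms by (intro mult_left_mono_neg) auto
  then have "excess (\<gamma> * x) \<le> excess (- \<gamma> * L)"
    using False assms by (intro excess_mono) (auto simp: mult_nonpos_nonpos)
  then show ?thesis using excess_nonneg[of "\<gamma> * U"] by linarith
qed

lemma excess_gain_le:
  assumes "\<gamma> \<le> 0" "0 \<le> U"
  shows "excess (\<gamma> * U) \<le> - \<gamma> * U"
proof -
  have "exp (\<gamma> * U) \<le> 1" using assms by (simp add: mult_nonpos_nonneg)
  then show ?thesis by (simp add: excess_def)
qed

text \<open>
  Convexity of the exponential on the segment from \<open>0\<close> to \<open>L\<close>.
\<close>

lemma excess_loss_le:
  assumes "-1 \<le> \<gamma>" "\<gamma> \<le> 0" "0 \<le> L"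
  shows "excess (- \<gamma> * L) \<le> - \<gamma> * exp L"
proof -
  have "exp ((1 - (- \<gamma>)) *\<^sub>R 0 + (- \<gamma>) *\<^sub>R L) \<le> (1 - (- \<gamma>)) * exp 0 + (- \<gamma>) * exp L"
    using assms by (intro convex_onD[OF exp_convex]) auto
  moreover have "0 \<le> - \<gamma> * L" using assms by (simp add: mult_nonpos_nonneg)
  ultimately show ?thesis using assms by (simp add: excess_def)
qed

lemma excess_div_tendsto: "((\<lambda>x. excess (x * a) / x) \<longlongrightarrow> 0) (at 0)"
proof -
  have "((\<lambda>x. excess (x * a)) has_real_derivative 0) (at 0)"
    unfolding excess_def by (auto intro!: derivative_eq_intros)
  then show ?thesis
    unfolding DERIV_def by (simp add: excess_def)
qed


section \<open>One period under the law of the returns\<close>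

text \<open>
  The law \<open>\<rho>\<close> of the gross returns over one waiting time, and a bounded value \<open>v\<close> of the weights
  reached at its end. The reward of a period is log growth plus this value; the surprise is the reward
  minus its mean.
\<close>

locale return_law = prob_space \<rho> for \<rho> :: "(real ^ 'd) measure" +
  fixes v :: "real ^ 'd \<Rightarrow> real" and V :: real
  assumes sets_law [measurable_cong]: "sets \<rho> = sets borel"
    and returns_pos: "AE y in \<rho>. \<forall>i. 0 < y $ i"
    and exp_log_min: "\<And>\<gamma>. \<gamma> < 0 \<Longrightarrow> integrable \<rho> (\<lambda>y. exp (\<gamma> * log_min y))"
    and integrable_log_max: "integrable \<rho> log_max"
    and v_measurable [measurable]: "v \<in> borel_measurable borel"
    and v_bound: "\<And>x. \<bar>v x\<bar> \<le> V"
begin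

definition reward :: "real ^ 'd \<Rightarrow> real ^ 'd \<Rightarrow> real" where
  "reward w y = ln (w \<bullet> y) + v (drift w y)"

definition mean_reward :: "real ^ 'd \<Rightarrow> real" where
  "mean_reward w = (\<integral>y. reward w y \<partial>\<rho>)"

definition surprise :: "real ^ 'd \<Rightarrow> real ^ 'd \<Rightarrow> real" where
  "surprise w y = reward w y - mean_reward w"

text \<open>
  \<open>slack\<close> absorbs the oscillation of \<open>v\<close> and the mean reward, so that the two bounds on the surprise
  are uniform over all weights on the simplex.
\<close>

definition slack :: real where
  "slack = 2 * V + \<bar>\<integral>y. log_min y \<partial>\<rho>\<bar> + \<bar>\<integral>y. log_max y \<partial>\<rho>\<bar>"

definition gain_bound :: "real ^ 'd \<Rightarrow> real" where
  "gain_bound y = max 0 (log_max y) + slack"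

definition loss_bound :: "real ^ 'd \<Rightarrow> real" where
  "loss_bound y = max 0 (- log_min y) + slack"

definition risk :: "real \<Rightarrow> real" where
  "risk \<gamma> = (\<integral>y. excess (\<gamma> * gain_bound y) + excess (- \<gamma> * loss_bound y) \<partial>\<rho>)"

lemma V_nonneg: "0 \<le> V"
  using v_bound[of 0] by linarith

lemma bounds_nonneg: "0 \<le> gain_bound y" "0 \<le> loss_bound y"
  using V_nonneg by (auto simp: gain_bound_def loss_bound_def slack_def)

lemma reward_measurable [measurable]:
  assumes [measurable]: "f \<in> borel_measurable N" "g \<in> borel_measurable N"
  shows "(\<lambda>x. reward (f x) (g x)) \<in> borel_measurable N"
  unfolding reward_def by measurable

lemma mean_reward_measurable [measurable]: "mean_reward \<in> borel_measurable borel"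
  unfolding mean_reward_def[abs_def] by (rule borel_measurable_lebesgue_integral) measurable

lemma surprise_measurable [measurable]:
  assumes [measurable]: "f \<in> borel_measurable N" "g \<in> borel_measurable N"
  shows "(\<lambda>x. surprise (f x) (g x)) \<in> borel_measurable N"
  unfolding surprise_def by measurable

lemma bound_measurable [measurable]:
  "gain_bound \<in> borel_measurable borel" "loss_bound \<in> borel_measurable borel"
  unfolding gain_bound_def[abs_def] loss_bound_def[abs_def] by measurable

lemma excess_measurable [measurable]: "excess \<in> borel_measurable borel"
  unfolding excess_def[abs_def] by measurable

lemma integrable_log_min: "integrable \<rho> log_min"
proof (rule Bochner_Integration.integrable_bound)
  show "integrable \<rho> (\<lambda>y. exp (- 1 * log_min y) + \<bar>log_max y\<bar>)"
    by (intro Bochner_Integration.integrable_add exp_log_min integrable_abs integrable_log_max) auto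
  show "AE y in \<rho>. norm (log_min y) \<le> norm (exp (- 1 * log_min y) + \<bar>log_max y\<bar>)"
  proof (rule AE_I2)
    fix y :: "real ^ 'd"
    show "norm (log_min y) \<le> norm (exp (- 1 * log_min y) + \<bar>log_max y\<bar>)"
      using le_exp_minus_one[of "- log_min y"] log_min_le_log_max[of y]
      by (cases "0 \<le> log_min y") (auto intro: add_increasing)
  qed
qed measurable

lemma reward_bounds:
  assumes w: "w \<in> unit_simplex" and y: "\<And>i. 0 < y $ i"
  shows "log_min y - V \<le> reward w y" "reward w y \<le> log_max y + V"
  using ln_inner_simplex_bounds[OF w y] v_bound[of "drift w y"] by (auto simp: reward_def)

lemma integrable_reward:
  assumes w: "w \<in> unit_simplex"
  shows "integrable \<rho> (reward w)"
proof (rule Bochner_Integration.integrable_bound)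
  show "integrable \<rho> (\<lambda>y. \<bar>log_min y\<bar> + \<bar>log_max y\<bar> + V)"
    by (intro Bochner_Integration.integrable_add integrable_abs integrable_log_max
        integrable_log_min) auto
  show "AE y in \<rho>. norm (reward w y) \<le> norm (\<bar>log_min y\<bar> + \<bar>log_max y\<bar> + V)"
    using returns_pos
  proof eventually_elim
    case (elim y)
    then show ?case using reward_bounds[OF w, of y] V_nonneg by auto
  qed
qed measurable

lemma mean_reward_bounds:
  assumes w: "w \<in> unit_simplex"
  shows "(\<integral>y. log_min y \<partial>\<rho>) - V \<le> mean_reward w" "mean_reward w \<le> (\<integral>y. log_max y \<partial>\<rho>) + V"
proof -
  have "(\<integral>y. log_min y - V \<partial>\<rho>) \<le> mean_reward w"
    unfolding mean_reward_def using returns_pos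
    by (intro integral_mono_AE integrable_reward[OF w] Bochner_Integration.integrable_diff
        integrable_log_min) (auto elim!: eventually_mono intro: reward_bounds[OF w])
  then show "(\<integral>y. log_min y \<partial>\<rho>) - V \<le> mean_reward w"
    by (simp add: integrable_log_min prob_space)
  have "mean_reward w \<le> (\<integral>y. log_max y + V \<partial>\<rho>)"
    unfolding mean_reward_def using returns_pos
    by (intro integral_mono_AE integrable_reward[OF w] Bochner_Integration.integrable_add
        integrable_log_max) (auto elim!: eventually_mono intro: reward_bounds[OF w])
  then show "mean_reward w \<le> (\<integral>y. log_max y \<partial>\<rho>) + V"
    by (simp add: integrable_log_max prob_space)
qed

lemma surprise_bounds:
  assumes w: "w \<in> unit_simplex" and y: "\<And>i. 0 < y $ i"
  shows "- loss_bound y \<le> surprise w y" "surprise w y \<le> gain_bound y"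
  using reward_bounds[OF w y] mean_reward_bounds[OF w]
  by (auto simp: surprise_def loss_bound_def gain_bound_def slack_def)

lemma integrable_surprise:
  assumes w: "w \<in> unit_simplex"
  shows "integrable \<rho> (surprise w)" "(\<integral>y. surprise w y \<partial>\<rho>) = 0"
  unfolding surprise_def[abs_def] using integrable_reward[OF w]
  by (auto simp: mean_reward_def prob_space)

lemma integrable_gain_bound: "integrable \<rho> gain_bound"
  unfolding gain_bound_def[abs_def] by (intro Bochner_Integration.integrable_add integrable_max
      integrable_log_max) auto

lemma integrable_exp_loss_bound:
  assumes "0 < s"
  shows "integrable \<rho> (\<lambda>y. exp (s * loss_bound y))"
proof (rule Bochner_Integration.integrable_bound)
  show "integrable \<rho> (\<lambda>y. exp (s * slack) * (1 + exp ((- s) * log_min y)))"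
    using assms by (intro integrable_mult_right Bochner_Integration.integrable_add exp_log_min) auto
  show "AE y in \<rho>. norm (exp (s * loss_bound y)) \<le> norm (exp (s * slack) * (1 + exp ((- s) * log_min y)))"
  proof (rule AE_I2)
    fix y :: "real ^ 'd"
    have "exp (s * max 0 (- log_min y)) \<le> 1 + exp ((- s) * log_min y)"
      by (auto simp: max_def add_increasing)
    then have "exp (s * slack) * exp (s * max 0 (- log_min y))
        \<le> exp (s * slack) * (1 + exp ((- s) * log_min y))"
      by (intro mult_left_mono) auto
    then show "norm (exp (s * loss_bound y)) \<le> norm (exp (s * slack) * (1 + exp ((- s) * log_min y)))"
      by (simp add: loss_bound_def distrib_left exp_add abs_mult add_nonneg_nonneg mult.commute)
  qed
qed measurable

lemma integrable_excess:
  assumes "\<gamma> < 0"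
  shows "integrable \<rho> (\<lambda>y. excess (\<gamma> * gain_bound y) + excess (- \<gamma> * loss_bound y))"
proof (rule Bochner_Integration.integrable_bound)
  show "integrable \<rho> (\<lambda>y. - \<gamma> * gain_bound y + exp (- \<gamma> * loss_bound y))"
    using assms by (intro Bochner_Integration.integrable_add integrable_mult_right
        integrable_gain_bound integrable_exp_loss_bound) auto
  show "AE y in \<rho>. norm (excess (\<gamma> * gain_bound y) + excess (- \<gamma> * loss_bound y))
      \<le> norm (- \<gamma> * gain_bound y + exp (- \<gamma> * loss_bound y))"
  proof (rule AE_I2)
    fix y :: "real ^ 'd"
    have "excess (\<gamma> * gain_bound y) \<le> - \<gamma> * gain_bound y"
      using assms bounds_nonneg[of y] by (intro excess_gain_le) auto
    moreover have "0 \<le> - \<gamma> * loss_bound y" 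
      using assms bounds_nonneg[of y] by (simp add: mult_nonpos_nonneg)
    then have "excess (- \<gamma> * loss_bound y) \<le> exp (- \<gamma> * loss_bound y)"
      by (simp add: excess_def)
    ultimately show "norm (excess (\<gamma> * gain_bound y) + excess (- \<gamma> * loss_bound y))
      \<le> norm (- \<gamma> * gain_bound y + exp (- \<gamma> * loss_bound y))"
      using excess_nonneg[of "\<gamma> * gain_bound y"] excess_nonneg[of "- \<gamma> * loss_bound y"] by simp
  qed
qed measurable

text \<open>
  The surprise is centred, so the linear term of the exponential drops out: the moment is at least one,
  and it exceeds one by no more than the mean remainder \<open>risk \<gamma>\<close>, for all weights alike.
\<close>

lemma exp_surprise:
  assumes w: "w \<in> unit_simplex" and g: "\<gamma> < 0"
  shows "1 \<le> (\<integral>\<^sup>+y. ennreal (exp (\<gamma> * surprise w y)) \<partial>\<rho>)"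
    and "(\<integral>\<^sup>+y. ennreal (exp (\<gamma> * surprise w y)) \<partial>\<rho>) \<le> ennreal (1 + risk \<gamma>)"
proof -
  let ?E = "\<lambda>y. excess (\<gamma> * surprise w y)"
  let ?B = "\<lambda>y. excess (\<gamma> * gain_bound y) + excess (- \<gamma> * loss_bound y)"
  have le: "AE y in \<rho>. ?E y \<le> ?B y"
    using returns_pos
  proof eventually_elim
    case (elim y)
    then show ?case
      using g bounds_nonneg by (intro excess_interval surprise_bounds[OF w]) auto
  qed
  have intE: "integrable \<rho> ?E"
  proof (rule Bochner_Integration.integrable_bound[OF integrable_excess[OF g]])
    show "AE y in \<rho>. norm (?E y) \<le> norm (?B y)"
      using le by eventually_elim (use excess_nonneg in auto)
  qed measurable
  have eq: "exp (\<gamma> * surprise w y) = 1 + \<gamma> * surprise w y + ?E y" for y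
    by (simp add: excess_def)
  have int: "integrable \<rho> (\<lambda>y. exp (\<gamma> * surprise w y))"
    unfolding eq using intE integrable_surprise[OF w]
    by (intro Bochner_Integration.integrable_add integrable_mult_right) auto
  have "(\<integral>y. exp (\<gamma> * surprise w y) \<partial>\<rho>) = 1 + \<gamma> * 0 + (\<integral>y. ?E y \<partial>\<rho>)"
    unfolding eq using intE integrable_surprise[OF w]
    by (subst Bochner_Integration.integral_add) (auto simp: prob_space)
  moreover have "0 \<le> (\<integral>y. ?E y \<partial>\<rho>)" using excess_nonneg by (intro Bochner_Integration.integral_nonneg) auto
  moreover have "(\<integral>y. ?E y \<partial>\<rho>) \<le> risk \<gamma>"
    unfolding risk_def by (intro integral_mono_AE intE integrable_excess[OF g] le)
  moreover have "(\<integral>\<^sup>+y. ennreal (exp (\<gamma> * surprise w y)) \<partial>\<rho>) = ennreal (\<integral>y. exp (\<gamma> * surprise w y) \<partial>\<rho>)"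
    using int by (intro nn_integral_eq_integral) auto
  ultimately show "1 \<le> (\<integral>\<^sup>+y. ennreal (exp (\<gamma> * surprise w y)) \<partial>\<rho>)"
    and "(\<integral>\<^sup>+y. ennreal (exp (\<gamma> * surprise w y)) \<partial>\<rho>) \<le> ennreal (1 + risk \<gamma>)"
    by (auto intro!: ennreal_leI simp flip: ennreal_1)
qed

lemma risk_nonneg: "0 \<le> risk \<gamma>"
  unfolding risk_def using excess_nonneg by (intro Bochner_Integration.integral_nonneg add_nonneg_nonneg) auto

text \<open>
  The mean remainder is of smaller order than \<open>\<gamma>\<close>. This is dominated convergence: divided by \<open>\<bar>\<gamma>\<bar>\<close>, for
  \<open>- 1 \<le> \<gamma> < 0\<close>, the remainder is at most \<open>gain_bound\<close> on gains and at most \<open>exp loss_bound\<close> on losses, and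
  it vanishes pointwise because the exponential has derivative one at zero. A second moment of the
  gains, which a quadratic estimate would call for, is avoided in this way.
\<close>

lemma risk_div_tendsto: "((\<lambda>\<gamma>. risk \<gamma> / \<gamma>) \<longlongrightarrow> 0) (at_left 0)"
  unfolding tendsto_at_iff_sequentially comp_def
proof safe
  fix X :: "nat \<Rightarrow> real"
  assume X: "\<forall>i. X i \<in> {..<0} - {0}" and lim: "X \<longlonglongrightarrow> 0"
  \<comment> \<open>domination is only available for \<open>- 1 \<le> \<gamma>\<close>, so the first terms are dropped\<close>
  have "\<forall>\<^sub>F n in sequentially. -1 < X n" using lim by (rule order_tendstoD) simp
  then obtain N where N: "\<And>n. N \<le> n \<Longrightarrow> -1 < X n" by (auto simp: eventually_sequentially)
  define Z where "Z n = X (n + N)" for n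
  have Z: "-1 < Z n" "Z n < 0" for n using N[of "n + N"] X by (auto simp: Z_def)
  have "Z \<longlonglongrightarrow> 0" unfolding Z_def using lim by (rule LIMSEQ_ignore_initial_segment)
  then have Z0: "filterlim Z (at 0) sequentially"
    using Z(2) by (auto simp: filterlim_at intro!: always_eventually) (metis less_irrefl)
  let ?f = "\<lambda>n y. (excess (Z n * gain_bound y) + excess (- Z n * loss_bound y)) / Z n"
  have "(\<lambda>n. \<integral>y. ?f n y \<partial>\<rho>) \<longlonglongrightarrow> (\<integral>y. 0 \<partial>\<rho>)"
  proof (rule integral_dominated_convergence[where w="\<lambda>y. gain_bound y + exp (1 * loss_bound y)"])
    show "integrable \<rho> (\<lambda>y. gain_bound y + exp (1 * loss_bound y))"
      by (intro Bochner_Integration.integrable_add integrable_gain_bound integrable_exp_loss_bound) auto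
    show "AE y in \<rho>. (\<lambda>n. ?f n y) \<longlonglongrightarrow> 0"
    proof (rule AE_I2)
      fix y :: "real ^ 'd"
      have "(\<lambda>n. excess (Z n * gain_bound y) / Z n + excess (Z n * (- loss_bound y)) / Z n) \<longlonglongrightarrow> 0 + 0"
        by (intro tendsto_add filterlim_compose[OF excess_div_tendsto Z0])
      then show "(\<lambda>n. ?f n y) \<longlonglongrightarrow> 0" by (simp add: add_divide_distrib)
    qed
    show "AE y in \<rho>. norm (?f n y) \<le> gain_bound y + exp (1 * loss_bound y)" for n
    proof (rule AE_I2)
      fix y :: "real ^ 'd"
      have "excess (Z n * gain_bound y) + excess (- Z n * loss_bound y)
          \<le> - Z n * gain_bound y + - Z n * exp (loss_bound y)"
        using Z[of n] bounds_nonneg[of y] by (intro add_mono excess_gain_le excess_loss_le) auto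
      also have "\<dots> = (gain_bound y + exp (loss_bound y)) * \<bar>Z n\<bar>"
        using Z[of n] by (simp add: algebra_simps)
      finally have "\<bar>excess (Z n * gain_bound y) + excess (- Z n * loss_bound y)\<bar>
          \<le> (gain_bound y + exp (loss_bound y)) * \<bar>Z n\<bar>"
        using excess_nonneg[of "Z n * gain_bound y"] excess_nonneg[of "- Z n * loss_bound y"] by simp
      then show "norm (?f n y) \<le> gain_bound y + exp (1 * loss_bound y)"
        using Z(2)[of n] by (simp only: real_norm_def abs_divide mult_1 pos_divide_le_eq zero_less_abs_iff)
    qed
  qed measurable
  then have "(\<lambda>n. risk (X (n + N)) / X (n + N)) \<longlonglongrightarrow> 0"
    by (simp add: risk_def Z_def)
  then show "(\<lambda>n. risk (X n) / X n) \<longlonglongrightarrow> 0" by (rule LIMSEQ_offset)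
qed

end


section \<open>The market seen at the rebalancing times\<close>

locale random_market = prob_space M for M :: "'w measure" +
  fixes S :: "real \<Rightarrow> 'w \<Rightarrow> real ^ 'd" and \<eta> :: "nat \<Rightarrow> 'w \<Rightarrow> real" and \<G> :: "nat \<Rightarrow> 'w measure"
  assumes market: "market M S \<eta>"
    and increments: "increments M S"
    and waiting_times: "waiting_times M \<eta>"
    and information: "information M S \<eta> \<G>"
begin

abbreviation period :: "nat \<Rightarrow> 'w \<Rightarrow> real ^ 'd" where
  "period n \<omega> \<equiv> gross S (tau \<eta> n \<omega>) (tau \<eta> (Suc n) \<omega>) \<omega>"

definition return_measure :: "(real ^ 'd) measure" where
  "return_measure = distr M borel (\<lambda>\<omega>. gross S 0 (\<eta> 1 \<omega>) \<omega>)"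

lemma S_measurable: "0 \<le> t \<Longrightarrow> S t \<in> borel_measurable M"
  and S_pos: "0 \<le> t \<Longrightarrow> \<omega> \<in> space M \<Longrightarrow> 0 < S t \<omega> $ i"
  and eta_measurable: "1 \<le> k \<Longrightarrow> \<eta> k \<in> borel_measurable M"
  and eta_pos: "1 \<le> k \<Longrightarrow> \<omega> \<in> space M \<Longrightarrow> 0 < \<eta> k \<omega>"
  and eta_law: "1 \<le> k \<Longrightarrow> distr M borel (\<eta> k) = distr M borel (\<eta> 1)"
  using market unfolding market_def by blast+

lemma tau_Suc: "tau \<eta> (Suc n) \<omega> = tau \<eta> n \<omega> + \<eta> (Suc n) \<omega>"
  by (simp add: tau_def)

lemma tau_0: "tau \<eta> 0 \<omega> = 0"
  by (simp add: tau_def)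

lemma tau_nonneg: "\<omega> \<in> space M \<Longrightarrow> 0 \<le> tau \<eta> n \<omega>"
  unfolding tau_def by (rule sum_nonneg) (simp add: eta_pos less_imp_le)

lemma gross_pos:
  assumes "0 \<le> a" "0 \<le> b" "\<omega> \<in> space M"
  shows "0 < gross S a b \<omega> $ i"
  using assms S_pos by (simp add: gross_def)

lemma period_pos: "\<omega> \<in> space M \<Longrightarrow> 0 < period n \<omega> $ i"
  by (intro gross_pos tau_nonneg)

lemma S_eq_exp_log_price:
  assumes "0 \<le> t" "\<omega> \<in> space M"
  shows "S t \<omega> $ i = exp (log_price S t \<omega> $ i)"
  using S_pos[OF assms] by (simp add: log_price_def)

lemma S_right_continuous:
  assumes t: "0 \<le> t" and \<omega>: "\<omega> \<in> space M"
  shows "continuous (at_right t) (\<lambda>u. S u \<omega>)"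
  unfolding continuous_within
proof (rule vec_tendstoI)
  fix i
  have "((\<lambda>u. log_price S u \<omega>) \<longlongrightarrow> log_price S t \<omega>) (at_right t)"
    using increments t \<omega> by (auto simp: increments_def continuous_within)
  then have "((\<lambda>u. exp (log_price S u \<omega> $ i)) \<longlongrightarrow> exp (log_price S t \<omega> $ i)) (at_right t)"
    by (intro tendsto_intros)
  moreover have "\<forall>\<^sub>F u in at_right t. exp (log_price S u \<omega> $ i) = S u \<omega> $ i"
    using eventually_at_right_less[of t]
  proof eventually_elim
    case (elim u)
    then show ?case using S_eq_exp_log_price[of u \<omega> i] t \<omega> by simp
  qed
  ultimately show "((\<lambda>u. S u \<omega> $ i) \<longlongrightarrow> S t \<omega> $ i) (at_right t)"
    unfolding S_eq_exp_log_price[OF t \<omega>, of i] by (rule Lim_transform_eventually)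
qed

lemma gross_right_continuous:
  assumes a: "0 \<le> a" and t: "0 \<le> t" and \<omega>: "\<omega> \<in> space M"
  shows "continuous (at_right t) (\<lambda>u. gross S a (a + u) \<omega>)"
  unfolding continuous_within
proof (rule vec_tendstoI)
  fix i
  have "filterlim (\<lambda>u. a + u) (at_right (a + t)) (at_right t)"
    unfolding filterlim_at
    by (auto intro!: tendsto_intros simp: eventually_at_filter)
  moreover have "((\<lambda>u. S u \<omega>) \<longlongrightarrow> S (a + t) \<omega>) (at_right (a + t))"
    using S_right_continuous[of "a + t" \<omega>] a t \<omega> by (auto simp: continuous_within)
  ultimately have "((\<lambda>u. S (a + u) \<omega>) \<longlongrightarrow> S (a + t) \<omega>) (at_right t)"
    by (rule filterlim_compose[rotated])
  then have "((\<lambda>u. S (a + u) \<omega> $ i / S a \<omega> $ i) \<longlongrightarrow> S (a + t) \<omega> $ i / S a \<omega> $ i) (at_right t)"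
    using S_pos[OF a \<omega>, of i] by (intro tendsto_intros) auto
  then show "((\<lambda>u. gross S a (a + u) \<omega> $ i) \<longlongrightarrow> gross S a (a + t) \<omega> $ i) (at_right t)"
    by (simp add: gross_def)
qed

lemma gross_measurable:
  assumes a: "0 \<le> a" and b: "0 \<le> b"
  shows "gross S a b \<in> borel_measurable M"
proof (rule measurable_vec_lambda)
  note [measurable] = S_measurable[OF a] S_measurable[OF b]
  show "(\<lambda>\<omega>. gross S a b \<omega> $ i) \<in> borel_measurable M" for i
    unfolding gross_def by simp
qed

lemma gross_stationary:
  assumes a: "0 \<le> a" and t: "0 \<le> t"
  shows "distr M borel (gross S a (a + t)) = distr M borel (gross S 0 t)"
proof -
  let ?e = "\<lambda>x :: real ^ 'd. (\<chi> i. exp (x $ i)) :: real ^ 'd"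
  have e [measurable]: "?e \<in> borel_measurable borel"
    by (rule measurable_vec_lambda) simp
  have lp: "log_price S u \<in> borel_measurable M" if "0 \<le> u" for u
  proof (rule measurable_vec_lambda)
    note [measurable] = S_measurable[OF that]
    show "(\<lambda>\<omega>. log_price S u \<omega> $ i) \<in> borel_measurable M" for i
      unfolding log_price_def by simp
  qed
  have push: "distr M borel (gross S b (b + t)) =
      distr (distr M borel (\<lambda>\<omega>. log_price S (b + t) \<omega> - log_price S b \<omega>)) borel ?e"
    if b: "0 \<le> b" for b
  proof -
    note [measurable] = lp[OF b] lp[of "b + t"]
    have [measurable]: "log_price S (b + t) \<in> borel_measurable M" using lp b t by simp
    have "gross S b (b + t) \<omega> = ?e (log_price S (b + t) \<omega> - log_price S b \<omega>)"
      if "\<omega> \<in> space M" for \<omega>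
      using b t that S_eq_exp_log_price[of "b + t" \<omega>] S_eq_exp_log_price[of b \<omega>]
      by (simp add: gross_def vec_eq_iff exp_diff)
    then show ?thesis
      by (subst distr_distr) (auto intro!: distr_cong)
  qed
  have "distr M borel (\<lambda>\<omega>. log_price S (a + t) \<omega> - log_price S a \<omega>) =
      distr M borel (\<lambda>\<omega>. log_price S (0 + t) \<omega> - log_price S 0 \<omega>)"
    using increments a t by (simp add: increments_def)
  then show ?thesis using push[OF a] push[of 0] by simp
qed

lemma subalgebra_information: "subalgebra M (\<G> n)"
  using information by (simp add: information_def)

lemma information_mono: "i \<le> n \<Longrightarrow> subalgebra (\<G> n) (\<G> i)"
proof (induction n rule: dec_induct)
  case base
  show ?case by (simp add: subalgebra_def)
next
  case (step n)
  then show ?case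
    using information subalgebra_information[of n] subalgebra_information[of "Suc n"]
    by (fastforce simp: information_def subalgebra_def)
qed

text \<open>
  The information at \<open>\<tau>\<^sub>n\<close> only speaks of the stopped path, which has reached the price at \<open>\<tau>\<^sub>n\<close> as soon
  as the running time exceeds \<open>\<tau>\<^sub>n\<close>.
\<close>

lemma S_tau_measurable: "(\<lambda>\<omega>. S (tau \<eta> n \<omega>) \<omega>) \<in> borel_measurable (\<G> n)"
proof (rule borel_measurable_LIMSEQ_metric)
  show "(\<lambda>\<omega>. S (min (real k) (tau \<eta> n \<omega>)) \<omega>) \<in> borel_measurable (\<G> n)" for k
    using information by (simp add: information_def)
  fix \<omega>
  obtain K :: nat where K: "tau \<eta> n \<omega> \<le> real K" using real_arch_simple by blast
  have "\<forall>\<^sub>F k in sequentially. S (tau \<eta> n \<omega>) \<omega> = S (min (real k) (tau \<eta> n \<omega>)) \<omega>"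
    using eventually_ge_at_top[of K] by eventually_elim (use K in \<open>simp add: min_absorb2\<close>)
  then show "(\<lambda>k. S (min (real k) (tau \<eta> n \<omega>)) \<omega>) \<longlonglongrightarrow> S (tau \<eta> n \<omega>) \<omega>"
    by (rule Lim_transform_eventually[OF tendsto_const])
qed

lemma period_adapted:
  assumes "i < n"
  shows "period i \<in> borel_measurable (\<G> n)"
proof (rule measurable_vec_lambda)
  have [measurable]: "(\<lambda>\<omega>. S (tau \<eta> i \<omega>) \<omega>) \<in> borel_measurable (\<G> n)"
    "(\<lambda>\<omega>. S (tau \<eta> (Suc i) \<omega>) \<omega>) \<in> borel_measurable (\<G> n)"
    by (rule measurable_from_subalg[OF information_mono S_tau_measurable]; use assms in simp)+
  show "(\<lambda>\<omega>. period i \<omega> $ k) \<in> borel_measurable (\<G> n)" for k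
    unfolding gross_def by simp
qed

lemma period_measurable [measurable]: "period n \<in> borel_measurable M"
  by (rule measurable_from_subalg[OF subalgebra_information[of "Suc n"] period_adapted]) simp

text \<open>
  The waiting times are independent of the prices, so they can be frozen (Fubini). For frozen times the
  increments are stationary, and the law of the return depends on the length of the period
  alone, not on its start \<open>\<tau>\<^sub>n\<close>. All waiting times have the same law.
\<close>

lemma period_law: "distr M borel (period n) = return_measure"
proof -
  let ?NE = "Pi\<^sub>M {1..} (\<lambda>_. borel) :: (nat \<Rightarrow> real) measure"
  let ?NS = "Pi\<^sub>M {0..} (\<lambda>_. borel) :: (real \<Rightarrow> real ^ 'd) measure"
  define waits where "waits \<omega> = (\<lambda>i\<in>{1..}. \<eta> i \<omega>)" for \<omega>
  define path where "path \<omega> = (\<lambda>t\<in>{0..}. S t \<omega>)" for \<omega>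
  \<comment> \<open>the gross return between two variable times, measurable jointly in the times and the path\<close>
  define ratio :: "real \<Rightarrow> real \<Rightarrow> (real \<Rightarrow> real ^ 'd) \<Rightarrow> real ^ 'd" where
    "ratio a b p = (\<chi> i. right_eval b p $ i / right_eval a p $ i)" for a b p
  have waits [measurable]: "waits \<in> M \<rightarrow>\<^sub>M ?NE"
    unfolding waits_def by (intro measurable_restrict eta_measurable) auto
  have path [measurable]: "path \<in> M \<rightarrow>\<^sub>M ?NS"
    unfolding path_def by (intro measurable_restrict S_measurable) auto
  have ratio_measurable:
    "(\<lambda>x. ratio (f x) (g x) (q x)) \<in> borel_measurable N"
    if "f \<in> borel_measurable N" "g \<in> borel_measurable N" "q \<in> N \<rightarrow>\<^sub>M ?NS"
    for f g q and N :: "'x measure"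
  proof (rule measurable_vec_lambda)
    note [measurable] = measurable_right_eval_compose[OF that(1) that(3)]
      measurable_right_eval_compose[OF that(2) that(3)]
    show "(\<lambda>x. ratio (f x) (g x) (q x) $ i) \<in> borel_measurable N" for i
      unfolding ratio_def by simp
  qed
  have ratio_path: "ratio a b (path \<omega>) = gross S a b \<omega>"
    if "0 \<le> a" "0 \<le> b" "\<omega> \<in> space M" for a b \<omega>
    using that by (simp add: ratio_def path_def gross_def right_eval_eq S_right_continuous)
  interpret P: prob_space "distr M ?NS path" by (rule prob_space_distr) fact
  have key: "emeasure (distr M borel (period n)) A =
      (\<integral>\<^sup>+t. \<integral>\<^sup>+p. indicator A (ratio 0 t p) \<partial>distr M ?NS path \<partial>distr M borel (\<eta> 1))"
    if A [measurable]: "A \<in> sets borel" for A and n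
  proof -
    define f :: "(nat \<Rightarrow> real) \<times> (real \<Rightarrow> real ^ 'd) \<Rightarrow> ennreal" where
      "f = (\<lambda>(e, p). indicator A (ratio (\<Sum>i = 1..n. e i) (\<Sum>i = 1..Suc n. e i) p))"
    have sum_measurable: "(\<lambda>x. \<Sum>i = 1..k. fst x i) \<in> borel_measurable (?NE \<Otimes>\<^sub>M ?NS)" for k
    proof (rule borel_measurable_sum)
      fix i assume "i \<in> {1..k}"
      then have "i \<in> {1..}" by simp
      then show "(\<lambda>x. fst x i) \<in> borel_measurable (?NE \<Otimes>\<^sub>M ?NS)"
        by (rule measurable_compose[OF measurable_fst measurable_component_singleton])
    qed
    have f: "f \<in> borel_measurable (?NE \<Otimes>\<^sub>M ?NS)"
      unfolding f_def split_beta'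
      by (rule measurable_compose[OF ratio_measurable[OF sum_measurable sum_measurable measurable_snd]
            borel_measurable_indicator[OF A]])
    have sums: "(\<Sum>i = 1..k. waits \<omega> i) = tau \<eta> k \<omega>" for k \<omega>
      unfolding tau_def by (intro sum.cong) (auto simp: waits_def)
    have f_path: "f (waits \<omega>, path \<omega>') = indicator A (gross S (tau \<eta> n \<omega>) (tau \<eta> (Suc n) \<omega>) \<omega>')"
      if "\<omega> \<in> space M" "\<omega>' \<in> space M" for \<omega> \<omega>'
      unfolding f_def prod.case sums using that by (simp add: ratio_path tau_nonneg)
    define g where "g t = (\<integral>\<^sup>+p. indicator A (ratio 0 t p) \<partial>distr M ?NS path)" for t
    have inner: "(\<lambda>(t, p). indicator A (ratio 0 t p) :: ennreal) \<in> borel_measurable (borel \<Otimes>\<^sub>M ?NS)"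
      unfolding split_beta'
      by (rule measurable_compose[OF ratio_measurable[OF borel_measurable_const measurable_fst
            measurable_snd] borel_measurable_indicator[OF A]])
    have "(\<lambda>(t, p). indicator A (ratio 0 t p) :: ennreal) \<in> borel_measurable (borel \<Otimes>\<^sub>M distr M ?NS path)"
      using inner by (simp cong: measurable_cong_sets sets_pair_measure_cong)
    from P.borel_measurable_nn_integral_fst[OF this]
    have g [measurable]: "g \<in> borel_measurable borel" by (simp add: g_def[abs_def])
    have g_eq: "g t = emeasure (distr M borel (gross S 0 t)) A" if t: "0 \<le> t" for t
    proof -
      have [measurable]: "gross S 0 t \<in> borel_measurable M" using gross_measurable t by simp
      have "g t = (\<integral>\<^sup>+\<omega>. indicator A (ratio 0 t (path \<omega>)) \<partial>M)"
        unfolding g_def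
        by (rule nn_integral_distr[OF path], subst measurable_distr_eq1)
          (rule measurable_compose[OF ratio_measurable[OF borel_measurable_const borel_measurable_const
            measurable_ident_sets[OF refl]] borel_measurable_indicator[OF A]])
      also have "\<dots> = (\<integral>\<^sup>+\<omega>. indicator A (gross S 0 t \<omega>) \<partial>M)"
        using t by (intro nn_integral_cong) (simp add: ratio_path)
      also have "\<dots> = (\<integral>\<^sup>+y. indicator A y \<partial>distr M borel (gross S 0 t))"
        by (subst nn_integral_distr) simp_all
      finally show ?thesis by simp
    qed
    have "emeasure (distr M borel (period n)) A = (\<integral>\<^sup>+y. indicator A y \<partial>distr M borel (period n))"
      by simp
    also have "\<dots> = (\<integral>\<^sup>+\<omega>. indicator A (period n \<omega>) \<partial>M)"
      by (subst nn_integral_distr) simp_all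
    also have "\<dots> = (\<integral>\<^sup>+\<omega>. f (waits \<omega>, path \<omega>) \<partial>M)"
      by (intro nn_integral_cong) (simp add: f_path)
    also have "\<dots> = (\<integral>\<^sup>+\<omega>. \<integral>\<^sup>+p. f (waits \<omega>, p) \<partial>distr M ?NS path \<partial>M)"
    proof (rule indep_nn_integral[OF waits path _ f])
      fix A B assume "A \<in> sets ?NE" "B \<in> sets ?NS"
      moreover have "indep_set (generated M waits ?NE) (generated M path ?NS)"
        using market unfolding market_def waits_def path_def by blast
      ultimately show "prob ((waits -` A \<inter> space M) \<inter> (path -` B \<inter> space M)) =
          prob (waits -` A \<inter> space M) * prob (path -` B \<inter> space M)"
        by (intro indep_setD) (auto simp: generated_def in_vimage_algebra)
    qed
    also have "\<dots> = (\<integral>\<^sup>+\<omega>. g (\<eta> (Suc n) \<omega>) \<partial>M)"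
    proof (rule nn_integral_cong)
      fix \<omega> assume \<omega>: "\<omega> \<in> space M"
      define a t where "a = tau \<eta> n \<omega>" and "t = \<eta> (Suc n) \<omega>"
      have at: "0 \<le> a" "0 \<le> t" using tau_nonneg eta_pos \<omega> by (auto simp: a_def t_def less_imp_le)
      have [measurable]: "gross S a (a + t) \<in> borel_measurable M" using gross_measurable at by simp
      have "waits \<omega> \<in> space ?NE" using waits \<omega> by (auto dest: measurable_space)
      then have "(\<lambda>p. f (waits \<omega>, p)) \<in> borel_measurable ?NS"
        by (intro measurable_compose[OF _ f]) simp
      then have "(\<integral>\<^sup>+p. f (waits \<omega>, p) \<partial>distr M ?NS path) = (\<integral>\<^sup>+\<omega>'. f (waits \<omega>, path \<omega>') \<partial>M)"
        by (intro nn_integral_distr[OF path]) simp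
      also have "\<dots> = (\<integral>\<^sup>+\<omega>'. indicator A (gross S a (a + t) \<omega>') \<partial>M)"
        using \<omega> by (intro nn_integral_cong) (simp add: f_path tau_Suc a_def t_def)
      also have "\<dots> = (\<integral>\<^sup>+y. indicator A y \<partial>distr M borel (gross S a (a + t)))"
        by (subst nn_integral_distr) simp_all
      also have "\<dots> = g t" by (simp add: gross_stationary[OF at] g_eq[OF at(2)])
      finally show "(\<integral>\<^sup>+p. f (waits \<omega>, p) \<partial>distr M ?NS path) = g (\<eta> (Suc n) \<omega>)"
        by (simp add: t_def)
    qed
    also have "\<dots> = (\<integral>\<^sup>+t. g t \<partial>distr M borel (\<eta> (Suc n)))"
      using eta_measurable[of "Suc n"] by (subst nn_integral_distr) simp_all
    also have "\<dots> = (\<integral>\<^sup>+t. g t \<partial>distr M borel (\<eta> 1))"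
      by (subst eta_law) simp_all
    finally show ?thesis by (simp add: g_def)
  qed
  have "distr M borel (period n) = distr M borel (period 0)"
    by (rule measure_eqI) (simp_all add: key)
  also have "\<dots> = return_measure"
    by (simp add: return_measure_def tau_Suc tau_0)
  finally show ?thesis .
qed

text \<open>
  The return over the next period is a measurable function of the next waiting time and of the price path
  after \<open>\<tau>\<^sub>n\<close>, hence independent of the information at \<open>\<tau>\<^sub>n\<close>.
\<close>

lemma period_indep:
  assumes F: "F \<in> \<G> n \<rightarrow>\<^sub>M N" and f: "f \<in> borel_measurable (N \<Otimes>\<^sub>M borel)"
  shows "(\<integral>\<^sup>+\<omega>. f (F \<omega>, period n \<omega>) \<partial>M) = (\<integral>\<^sup>+\<omega>. \<integral>\<^sup>+y. f (F \<omega>, y) \<partial>return_measure \<partial>M)"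
proof -
  have FM: "F \<in> M \<rightarrow>\<^sub>M N" by (rule measurable_from_subalg[OF subalgebra_information F])
  let ?N = "(Pi\<^sub>M {n<..} (\<lambda>_. borel) :: (nat \<Rightarrow> real) measure) \<Otimes>\<^sub>M
    (Pi\<^sub>M {0..} (\<lambda>_. borel) :: (real \<Rightarrow> real ^ 'd) measure)"
  define fut where "fut \<omega> = ((\<lambda>k\<in>{n<..}. \<eta> k \<omega>),
    (\<lambda>t\<in>{0..}. gross S (tau \<eta> n \<omega>) (tau \<eta> n \<omega> + t) \<omega>))" for \<omega>
  define ev where "ev = (\<lambda>(e, p). right_eval (e (Suc n)) p :: real ^ 'd)"
  have e: "(\<lambda>x. fst x (Suc n)) \<in> borel_measurable ?N"
    by (rule measurable_compose[OF measurable_fst measurable_component_singleton]) simp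
  have ev: "ev \<in> ?N \<rightarrow>\<^sub>M borel"
    unfolding ev_def split_beta'
    by (rule measurable_right_eval_compose[OF e measurable_snd])
  have fut_space: "fut \<omega> \<in> space ?N" for \<omega>
    by (simp add: fut_def space_pair_measure space_PiM)
  \<comment> \<open>right-continuity recovers the next return from the future waiting times and prices\<close>
  have period_eq: "period n \<omega> = ev (fut \<omega>)" if "\<omega> \<in> space M" for \<omega>
    using that eta_pos[of "Suc n" \<omega>]
    by (simp add: ev_def fut_def tau_Suc right_eval_eq gross_right_continuous tau_nonneg less_imp_le)
  have "(\<integral>\<^sup>+\<omega>. f (F \<omega>, period n \<omega>) \<partial>M) =
      (\<integral>\<^sup>+\<omega>. \<integral>\<^sup>+y. f (F \<omega>, y) \<partial>distr M borel (period n) \<partial>M)"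
  proof (rule indep_nn_integral[OF FM period_measurable _ f])
    fix A and B :: "(real ^ 'd) set" assume A: "A \<in> sets N" and B: "B \<in> sets borel"
    have "indep_set (generated M fut ?N) (sets (\<G> n))"
      using information unfolding information_def fut_def by blast
    moreover have "period n -` B \<inter> space M = fut -` (ev -` B \<inter> space ?N) \<inter> space M"
      using fut_space period_eq by auto
    then have "period n -` B \<inter> space M \<in> generated M fut ?N"
      using measurable_sets[OF ev B] by (simp only: generated_def in_vimage_algebra)
    moreover have "F -` A \<inter> space M \<in> sets (\<G> n)"
      using measurable_sets[OF F A] subalgebra_information[of n] by (simp add: subalgebra_def)
    ultimately have "prob ((period n -` B \<inter> space M) \<inter> (F -` A \<inter> space M)) =
        prob (period n -` B \<inter> space M) * prob (F -` A \<inter> space M)"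
      by (rule indep_setD)
    then show "prob ((F -` A \<inter> space M) \<inter> (period n -` B \<inter> space M)) =
        prob (F -` A \<inter> space M) * prob (period n -` B \<inter> space M)"
      by (simp add: Int_commute mult.commute)
  qed
  then show ?thesis by (simp add: period_law)
qed

lemma strategy_weights:
  assumes "W \<in> strategies M S \<eta> \<G> \<pi>"
  shows "(\<lambda>\<omega>. W (tau \<eta> n \<omega>) \<omega>) \<in> borel_measurable (\<G> n)"
    and "\<omega> \<in> space M \<Longrightarrow> W (tau \<eta> n \<omega>) \<omega> \<in> unit_simplex"
  using assms tau_nonneg by (auto simp: strategies_def)

text \<open>
  Peeling off the last factor by independence replaces it with a one-period integral at weights that are
  already known; a bound on that integral uniform in the weights therefore compounds geometrically.
\<close>

lemma adapted_product_bounds: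
  fixes \<Phi> :: "real ^ 'd \<Rightarrow> real ^ 'd \<Rightarrow> ennreal"
  assumes W: "W \<in> strategies M S \<eta> \<G> \<pi>"
    and \<Phi>: "(\<lambda>(w, y). \<Phi> w y) \<in> borel_measurable (borel \<Otimes>\<^sub>M borel)"
    and bounds: "\<And>w. w \<in> unit_simplex \<Longrightarrow> a \<le> (\<integral>\<^sup>+y. \<Phi> w y \<partial>return_measure)"
      "\<And>w. w \<in> unit_simplex \<Longrightarrow> (\<integral>\<^sup>+y. \<Phi> w y \<partial>return_measure) \<le> b"
  shows "a ^ n \<le> (\<integral>\<^sup>+\<omega>. (\<Prod>i<n. \<Phi> (W (tau \<eta> i \<omega>) \<omega>) (period i \<omega>)) \<partial>M)"
    and "(\<integral>\<^sup>+\<omega>. (\<Prod>i<n. \<Phi> (W (tau \<eta> i \<omega>) \<omega>) (period i \<omega>)) \<partial>M) \<le> b ^ n"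
proof -
  let ?w = "\<lambda>i \<omega>. W (tau \<eta> i \<omega>) \<omega>"
  let ?P = "\<lambda>n \<omega>. \<Prod>i<n. \<Phi> (?w i \<omega>) (period i \<omega>)"
  have term_measurable: "(\<lambda>\<omega>. \<Phi> (?w i \<omega>) (period i \<omega>)) \<in> borel_measurable (\<G> n)" if "i < n" for i n
    using measurable_compose[OF measurable_Pair[OF measurable_from_subalg[OF information_mono
      strategy_weights(1)[OF W]] period_adapted] \<Phi>] that by simp
  have P: "?P n \<in> borel_measurable (\<G> n)" for n
    by (intro borel_measurable_prod_ennreal term_measurable) auto
  note PM = measurable_from_subalg[OF subalgebra_information P]
  have step: "(\<integral>\<^sup>+\<omega>. ?P (Suc n) \<omega> \<partial>M) =
      (\<integral>\<^sup>+\<omega>. ?P n \<omega> * (\<integral>\<^sup>+y. \<Phi> (?w n \<omega>) y \<partial>return_measure) \<partial>M)" for n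
  proof -
    let ?f = "\<lambda>((p, w), y). p * \<Phi> w y"
    have "(\<lambda>x. \<Phi> (snd (fst x)) (snd x)) \<in> borel_measurable ((borel \<Otimes>\<^sub>M borel) \<Otimes>\<^sub>M borel)"
      using measurable_compose[OF measurable_Pair[OF measurable_compose[OF measurable_fst measurable_snd]
        measurable_snd] \<Phi>] by simp
    then have f: "?f \<in> borel_measurable ((borel \<Otimes>\<^sub>M borel) \<Otimes>\<^sub>M borel)"
      unfolding split_beta' by measurable
    have "(\<integral>\<^sup>+\<omega>. ?f ((?P n \<omega>, ?w n \<omega>), period n \<omega>) \<partial>M) =
        (\<integral>\<^sup>+\<omega>. \<integral>\<^sup>+y. ?f ((?P n \<omega>, ?w n \<omega>), y) \<partial>return_measure \<partial>M)"
      by (rule period_indep[OF measurable_Pair[OF P strategy_weights(1)[OF W]] f])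
    also have "\<dots> = (\<integral>\<^sup>+\<omega>. ?P n \<omega> * (\<integral>\<^sup>+y. \<Phi> (?w n \<omega>) y \<partial>return_measure) \<partial>M)"
    proof (rule nn_integral_cong)
      fix \<omega>
      have "(\<lambda>y. \<Phi> (?w n \<omega>) y) \<in> borel_measurable borel"
        using measurable_compose[OF measurable_Pair1' \<Phi>, of "?w n \<omega>"] by simp
      then show "(\<integral>\<^sup>+y. ?f ((?P n \<omega>, ?w n \<omega>), y) \<partial>return_measure) =
          ?P n \<omega> * (\<integral>\<^sup>+y. \<Phi> (?w n \<omega>) y \<partial>return_measure)"
        by (simp add: nn_integral_cmult return_measure_def)
    qed
    finally show ?thesis by (simp add: lessThan_Suc mult.commute)
  qed
  show "a ^ n \<le> (\<integral>\<^sup>+\<omega>. ?P n \<omega> \<partial>M)"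
  proof (induction n)
    case 0
    show ?case by (simp add: emeasure_space_1)
  next
    case (Suc n)
    have "a ^ Suc n \<le> (\<integral>\<^sup>+\<omega>. ?P n \<omega> \<partial>M) * a"
      using mult_right_mono[OF Suc, of a] by (simp add: mult.commute)
    also have "\<dots> = (\<integral>\<^sup>+\<omega>. ?P n \<omega> * a \<partial>M)" by (simp add: nn_integral_multc[OF PM])
    also have "\<dots> \<le> (\<integral>\<^sup>+\<omega>. ?P (Suc n) \<omega> \<partial>M)"
      unfolding step by (intro nn_integral_mono mult_left_mono bounds strategy_weights(2)[OF W]) auto
    finally show ?case .
  qed
  show "(\<integral>\<^sup>+\<omega>. ?P n \<omega> \<partial>M) \<le> b ^ n"
  proof (induction n)
    case 0
    show ?case by (simp add: emeasure_space_1)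
  next
    case (Suc n)
    have "(\<integral>\<^sup>+\<omega>. ?P (Suc n) \<omega> \<partial>M) \<le> (\<integral>\<^sup>+\<omega>. ?P n \<omega> * b \<partial>M)"
      unfolding step by (intro nn_integral_mono mult_left_mono bounds strategy_weights(2)[OF W]) auto
    also have "\<dots> = (\<integral>\<^sup>+\<omega>. ?P n \<omega> \<partial>M) * b" by (simp add: nn_integral_multc[OF PM])
    also have "\<dots> \<le> b ^ Suc n"
      using mult_right_mono[OF Suc, of b] by (simp add: mult.commute)
    finally show ?case .
  qed
qed

definition mean_wait :: real where
  "mean_wait = (\<integral>\<omega>. \<eta> 1 \<omega> \<partial>M)"

lemma mean_wait_pos: "0 < mean_wait"
proof -
  have "(\<integral>\<omega>. 0 \<partial>M) < (\<integral>\<omega>. \<eta> 1 \<omega> \<partial>M)"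
    using waiting_times eta_pos[of 1]
    by (intro integral_less_AE_space) (auto simp: waiting_times_def emeasure_space_1)
  then show ?thesis by (simp add: mean_wait_def)
qed

lemma mean_tau: "(\<integral>\<omega>. tau \<eta> n \<omega> \<partial>M) = real n * mean_wait"
proof -
  have eq: "(\<integral>\<omega>. \<eta> i \<omega> \<partial>M) = mean_wait" if "1 \<le> i" for i
  proof -
    have "(\<integral>x. x \<partial>distr M borel (\<eta> i)) = (\<integral>x. x \<partial>distr M borel (\<eta> 1))"
      by (subst eta_law[OF that]) simp
    then show ?thesis
      using eta_measurable[OF that] eta_measurable[of 1] by (simp add: integral_distr mean_wait_def)
  qed
  have "(\<integral>\<omega>. tau \<eta> n \<omega> \<partial>M) = (\<Sum>i = 1..n. \<integral>\<omega>. \<eta> i \<omega> \<partial>M)"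
    unfolding tau_def using waiting_times
    by (intro Bochner_Integration.integral_sum) (auto simp: waiting_times_def)
  also have "\<dots> = (\<Sum>i = 1..n. mean_wait)" by (intro sum.cong eq) auto
  finally show ?thesis by simp
qed

end


section \<open>Long-run growth with a solution of the Bellman equation\<close>

locale bellman_market = random_market M S \<eta> \<G>
  for M :: "'w measure" and S :: "real \<Rightarrow> 'w \<Rightarrow> real ^ 'd"
    and \<eta> :: "nat \<Rightarrow> 'w \<Rightarrow> real" and \<G> :: "nat \<Rightarrow> 'w measure" +
  fixes c h :: "real ^ 'd" and v :: "real ^ 'd \<Rightarrow> real" and l V :: real
  assumes c: "cost_rates c" and h: "cost_rates h"
    and integrability: "integrability M S \<eta>"
    and bellman: "bellman_solution M S \<eta> c h v l"
    and V: "\<And>\<pi>. \<pi> \<in> unit_simplex \<Longrightarrow> \<bar>v \<pi>\<bar> \<le> V"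
begin

text \<open>
  Extension by zero turns a function that is bounded and continuous on the closed simplex into one that is
  bounded and Borel measurable on the whole space.
\<close>

definition v0 :: "real ^ 'd \<Rightarrow> real" where
  "v0 \<pi> = (if \<pi> \<in> unit_simplex then v \<pi> else 0)"

lemma first_return_measurable: "(\<lambda>\<omega>. gross S 0 (\<eta> 1 \<omega>) \<omega>) \<in> borel_measurable M"
  using period_measurable[of 0] by (simp add: tau_Suc tau_0)

lemma first_return_pos: "\<omega> \<in> space M \<Longrightarrow> 0 < gross S 0 (\<eta> 1 \<omega>) \<omega> $ i"
  using eta_pos[of 1] by (intro gross_pos) (auto intro: less_imp_le)

sublocale R: return_law return_measure v0 V
proof -
  note [measurable] = first_return_measurable
  interpret R: prob_space return_measure
    unfolding return_measure_def by (rule prob_space_distr) measurable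
  have returns: "Min (range (\<lambda>i. log_return S (\<eta> 1 \<omega>) \<omega> $ i)) = log_min (gross S 0 (\<eta> 1 \<omega>) \<omega>)"
    "Max (range (\<lambda>i. log_return S (\<eta> 1 \<omega>) \<omega> $ i)) = log_max (gross S 0 (\<eta> 1 \<omega>) \<omega>)" for \<omega>
    by (simp_all add: log_return_def log_min_def log_max_def)
  show "return_law return_measure v0 V"
  proof
    show "sets return_measure = sets borel" by (simp add: return_measure_def)
    have [measurable]: "Measurable.pred borel (\<lambda>y :: real ^ 'd. \<forall>i. 0 < y $ i)"
      by measurable
    show "AE y in return_measure. \<forall>i. 0 < y $ i"
      unfolding return_measure_def
      by (subst AE_distr_iff[OF first_return_measurable], measurable)
        (intro AE_I2 allI first_return_pos)
    show "integrable return_measure (\<lambda>y. exp (\<gamma> * log_min y))" if "\<gamma> < 0" for \<gamma>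
      unfolding return_measure_def using integrability that
      by (subst integrable_distr_eq[OF first_return_measurable])
        (measurable, simp only: integrability_def returns)
    show "integrable return_measure log_max"
      unfolding return_measure_def using integrability
      by (subst integrable_distr_eq[OF first_return_measurable])
        (measurable, simp only: integrability_def returns)
    have "v0 = (\<lambda>x. indicator unit_simplex x *\<^sub>R v x)"
      by (auto simp: v0_def)
    then show "v0 \<in> borel_measurable borel"
      using borel_measurable_continuous_on_indicator[OF borel_closed[OF closed_unit_simplex], of v] bellman
      by (simp add: bellman_solution_def)
    have "0 \<le> V" using V unit_simplex_nonempty by (metis abs_ge_zero equals0I order_trans)
    then show "\<bar>v0 x\<bar> \<le> V" for x using V by (simp add: v0_def)
  qed
qed

lemma bellman_term_eq:
  assumes "\<pi>' \<in> unit_simplex"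
  shows "bellman_term M S \<eta> c h v l \<pi> \<pi>' =
    ln (shrink c h \<pi> \<pi>') - l * mean_wait + R.mean_reward \<pi>'"
proof -
  note [measurable] = first_return_measurable
  have "(\<integral>\<omega>. ln (\<pi>' \<bullet> gross S 0 (\<eta> 1 \<omega>) \<omega>) + v (drift \<pi>' (gross S 0 (\<eta> 1 \<omega>) \<omega>)) \<partial>M) =
      (\<integral>\<omega>. R.reward \<pi>' (gross S 0 (\<eta> 1 \<omega>) \<omega>) \<partial>M)"
    using drift_simplex[OF assms first_return_pos]
    by (intro Bochner_Integration.integral_cong) (simp_all add: R.reward_def v0_def)
  also have "\<dots> = R.mean_reward \<pi>'"
    unfolding R.mean_reward_def by (subst return_measure_def, subst integral_distr[OF first_return_measurable]) simp_all
  finally show ?thesis by (simp add: bellman_term_def mean_wait_def)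
qed

lemma bellman_term_le:
  assumes "\<pi> \<in> unit_simplex" "\<pi>' \<in> unit_simplex"
  shows "bellman_term M S \<eta> c h v l \<pi> \<pi>' \<le> v \<pi>"
proof -
  have "ereal (bellman_term M S \<eta> c h v l \<pi> \<pi>') \<le> ereal (v \<pi>)"
    using bellman assms by (auto simp: bellman_solution_def intro: SUP_upper)
  then show ?thesis by simp
qed

lemma bellman_term_arg_max:
  assumes p: "\<pi> \<in> unit_simplex"
    and w: "is_arg_max (bellman_term M S \<eta> c h v l \<pi>) (\<lambda>\<pi>'. \<pi>' \<in> unit_simplex) w"
  shows "bellman_term M S \<eta> c h v l \<pi> w = v \<pi>"
proof (rule antisym)
  have ws: "w \<in> unit_simplex" using w by (simp add: is_arg_max_def)
  then show "bellman_term M S \<eta> c h v l \<pi> w \<le> v \<pi>" by (rule bellman_term_le[OF p])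
  have "(SUP \<pi>'\<in>unit_simplex. ereal (bellman_term M S \<eta> c h v l \<pi> \<pi>')) \<le>
      ereal (bellman_term M S \<eta> c h v l \<pi> w)"
    using w by (intro SUP_least) (auto simp: is_arg_max_def not_less)
  moreover have "ereal (v \<pi>) = (SUP \<pi>'\<in>unit_simplex. ereal (bellman_term M S \<eta> c h v l \<pi> \<pi>'))"
    using bellman p by (simp add: bellman_solution_def)
  ultimately show "v \<pi> \<le> bellman_term M S \<eta> c h v l \<pi> w"
    by (metis ereal_less_eq(3))
qed

definition log_wealth :: "real ^ 'd \<Rightarrow> (real \<Rightarrow> 'w \<Rightarrow> real ^ 'd) \<Rightarrow> nat \<Rightarrow> 'w \<Rightarrow> real" where
  "log_wealth \<pi> W n \<omega> = (\<Sum>i<n.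
     ln (shrink c h (pre_weights S \<eta> \<pi> W i \<omega>) (W (tau \<eta> i \<omega>) \<omega>)) +
     ln (W (tau \<eta> i \<omega>) \<omega> \<bullet> period i \<omega>))"

definition total_surprise :: "(real \<Rightarrow> 'w \<Rightarrow> real ^ 'd) \<Rightarrow> nat \<Rightarrow> 'w \<Rightarrow> real" where
  "total_surprise W n \<omega> = (\<Sum>i<n. R.surprise (W (tau \<eta> i \<omega>) \<omega>) (period i \<omega>))"

context
  fixes \<pi> :: "real ^ 'd" and W :: "real \<Rightarrow> 'w \<Rightarrow> real ^ 'd"
  assumes pi: "\<pi> \<in> unit_simplex" and W: "W \<in> strategies M S \<eta> \<G> \<pi>"
begin

lemma pre_weights_simplex: "\<omega> \<in> space M \<Longrightarrow> pre_weights S \<eta> \<pi> W n \<omega> \<in> unit_simplex"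
  using pi by (cases n)
    (auto simp: pre_weights_def intro!: drift_simplex strategy_weights(2)[OF W] period_pos)

lemma weights_measurable [measurable]: "(\<lambda>\<omega>. W (tau \<eta> n \<omega>) \<omega>) \<in> borel_measurable M"
  by (rule measurable_from_subalg[OF subalgebra_information strategy_weights(1)[OF W]])

lemma pre_weights_measurable [measurable]: "pre_weights S \<eta> \<pi> W n \<in> borel_measurable M"
proof (cases n)
  case 0
  then show ?thesis by (simp add: pre_weights_def[abs_def])
next
  case (Suc m)
  have "(\<lambda>\<omega>. drift (W (tau \<eta> m \<omega>) \<omega>) (period m \<omega>)) \<in> borel_measurable M"
    by (intro measurable_drift weights_measurable period_measurable)
  then show ?thesis by (simp add: Suc pre_weights_def[abs_def])
qed

lemma log_wealth_measurable [measurable]: "log_wealth \<pi> W n \<in> borel_measurable M"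
  unfolding log_wealth_def[abs_def]
proof (intro borel_measurable_sum borel_measurable_add borel_measurable_ln)
  fix i
  show "(\<lambda>\<omega>. shrink c h (pre_weights S \<eta> \<pi> W i \<omega>) (W (tau \<eta> i \<omega>) \<omega>)) \<in> borel_measurable M"
    by (intro measurable_shrink c h pre_weights_measurable weights_measurable pre_weights_simplex
        strategy_weights(2)[OF W])
  show "(\<lambda>\<omega>. W (tau \<eta> i \<omega>) \<omega> \<bullet> period i \<omega>) \<in> borel_measurable M"
    by (intro borel_measurable_inner weights_measurable period_measurable)
qed

lemma surprise_plus_value:
  assumes \<omega>: "\<omega> \<in> space M"
  shows "R.surprise (W (tau \<eta> n \<omega>) \<omega>) (period n \<omega>) =
    ln (W (tau \<eta> n \<omega>) \<omega> \<bullet> period n \<omega>) + v (pre_weights S \<eta> \<pi> W (Suc n) \<omega>)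
    - R.mean_reward (W (tau \<eta> n \<omega>) \<omega>)"
  using pre_weights_simplex[OF \<omega>, of "Suc n"]
  by (simp add: R.surprise_def R.reward_def v0_def pre_weights_def)

text \<open>
  Over each period, log wealth plus value changes by the constant \<open>l\<close> times the mean waiting time, plus
  the surprise, minus the amount by which the chosen weights miss the maximum in the Bellman equation.
\<close>

lemma log_wealth_telescope:
  assumes \<omega>: "\<omega> \<in> space M"
  shows "log_wealth \<pi> W n \<omega> + v (pre_weights S \<eta> \<pi> W n \<omega>) =
    v \<pi> + real n * (l * mean_wait) + total_surprise W n \<omega>
    - (\<Sum>i<n. v (pre_weights S \<eta> \<pi> W i \<omega>) -
        bellman_term M S \<eta> c h v l (pre_weights S \<eta> \<pi> W i \<omega>) (W (tau \<eta> i \<omega>) \<omega>))"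
proof (induction n)
  case 0
  show ?case by (simp add: log_wealth_def total_surprise_def pre_weights_def)
next
  case (Suc n)
  have "bellman_term M S \<eta> c h v l (pre_weights S \<eta> \<pi> W n \<omega>) (W (tau \<eta> n \<omega>) \<omega>) =
      ln (shrink c h (pre_weights S \<eta> \<pi> W n \<omega>) (W (tau \<eta> n \<omega>) \<omega>)) - l * mean_wait
      + R.mean_reward (W (tau \<eta> n \<omega>) \<omega>)"
    by (rule bellman_term_eq[OF strategy_weights(2)[OF W \<omega>]])
  then show ?case
    using Suc surprise_plus_value[OF \<omega>, of n]
    by (simp add: log_wealth_def total_surprise_def algebra_simps)
qed

lemma log_wealth_le:
  assumes \<omega>: "\<omega> \<in> space M"
  shows "log_wealth \<pi> W n \<omega> \<le> 2 * V + real n * (l * mean_wait) + total_surprise W n \<omega>"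
proof -
  have "0 \<le> (\<Sum>i<n. v (pre_weights S \<eta> \<pi> W i \<omega>) -
        bellman_term M S \<eta> c h v l (pre_weights S \<eta> \<pi> W i \<omega>) (W (tau \<eta> i \<omega>) \<omega>))"
    using bellman_term_le[OF pre_weights_simplex[OF \<omega>] strategy_weights(2)[OF W \<omega>]]
    by (intro sum_nonneg) simp
  then show ?thesis
    using log_wealth_telescope[OF \<omega>, of n] V[OF pi] V[OF pre_weights_simplex[OF \<omega>, of n]] by linarith
qed

lemma log_wealth_bellman_ge:
  assumes \<omega>: "\<omega> \<in> space M" and opt: "bellman_strategy M S \<eta> \<G> c h v l \<pi> W"
  shows "- 2 * V + real n * (l * mean_wait) + total_surprise W n \<omega> \<le> log_wealth \<pi> W n \<omega>"
proof -
  have "bellman_term M S \<eta> c h v l (pre_weights S \<eta> \<pi> W i \<omega>) (W (tau \<eta> i \<omega>) \<omega>) =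
      v (pre_weights S \<eta> \<pi> W i \<omega>)" for i
    using opt \<omega> by (intro bellman_term_arg_max pre_weights_simplex) (auto simp: bellman_strategy_def)
  then show ?thesis
    using log_wealth_telescope[OF \<omega>, of n] V[OF pi] V[OF pre_weights_simplex[OF \<omega>, of n]] by simp
qed

lemma exp_total_surprise_bounds:
  assumes g: "\<gamma> < 0"
  shows "1 \<le> (\<integral>\<^sup>+\<omega>. ennreal (exp (\<gamma> * total_surprise W n \<omega>)) \<partial>M)"
    and "(\<integral>\<^sup>+\<omega>. ennreal (exp (\<gamma> * total_surprise W n \<omega>)) \<partial>M) \<le> ennreal (1 + R.risk \<gamma>) ^ n"
proof -
  have eq: "ennreal (exp (\<gamma> * total_surprise W n \<omega>)) =
      (\<Prod>i<n. ennreal (exp (\<gamma> * R.surprise (W (tau \<eta> i \<omega>) \<omega>) (period i \<omega>))))" for \<omega>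
    by (simp add: total_surprise_def sum_distrib_left exp_sum prod_ennreal)
  have "(\<lambda>(w, y). ennreal (exp (\<gamma> * R.surprise w y))) \<in> borel_measurable (borel \<Otimes>\<^sub>M borel)"
    by measurable
  note b = adapted_product_bounds[OF W this R.exp_surprise(1)[OF _ g] R.exp_surprise(2)[OF _ g], of n]
  show "1 \<le> (\<integral>\<^sup>+\<omega>. ennreal (exp (\<gamma> * total_surprise W n \<omega>)) \<partial>M)"
    unfolding eq using b(1) by simp
  show "(\<integral>\<^sup>+\<omega>. ennreal (exp (\<gamma> * total_surprise W n \<omega>)) \<partial>M) \<le> ennreal (1 + R.risk \<gamma>) ^ n"
    unfolding eq by (rule b(2))
qed

text \<open>
  The entropic utility is defined through a Bochner integral, which is zero for functions that are not
  integrable; without this lemma the estimates below would say nothing about it. Rebalancing and the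
  portfolio return lose at most a constant and the worst asset return, whatever the weights.
\<close>

lemma integrable_exp_log_wealth:
  assumes g: "\<gamma> < 0"
  shows "integrable M (\<lambda>\<omega>. exp (\<gamma> * log_wealth \<pi> W n \<omega>))"
proof (rule integrableI_nonneg)
  define \<kappa> where "\<kappa> = ln ((1 - max_rate h) / 2)"
  define \<Phi> :: "real ^ 'd \<Rightarrow> real ^ 'd \<Rightarrow> ennreal" where
    "\<Phi> w y = ennreal (exp (\<gamma> * \<kappa>) * exp (\<gamma> * log_min y))" for w y
  have le: "ennreal (exp (\<gamma> * log_wealth \<pi> W n \<omega>)) \<le> (\<Prod>i<n. \<Phi> (W (tau \<eta> i \<omega>) \<omega>) (period i \<omega>))"
    if \<omega>: "\<omega> \<in> space M" for \<omega>
  proof -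
    have "(\<Sum>i<n. \<kappa> + log_min (period i \<omega>)) \<le> log_wealth \<pi> W n \<omega>"
      unfolding log_wealth_def
    proof (intro sum_mono add_mono)
      fix i
      have pos: "0 < (1 - max_rate h) / 2" using max_rate(2)[OF h] by simp
      moreover note shrink_lower_bound[OF c h pre_weights_simplex[OF \<omega>, of i]
          strategy_weights(2)[OF W \<omega>, of i]]
      ultimately show "\<kappa> \<le> ln (shrink c h (pre_weights S \<eta> \<pi> W i \<omega>) (W (tau \<eta> i \<omega>) \<omega>))"
        unfolding \<kappa>_def by (subst ln_le_cancel_iff) linarith+
      show "log_min (period i \<omega>) \<le> ln (W (tau \<eta> i \<omega>) \<omega> \<bullet> period i \<omega>)"
        by (intro ln_inner_simplex_bounds strategy_weights(2)[OF W \<omega>] period_pos \<omega>)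
    qed
    then have "\<gamma> * log_wealth \<pi> W n \<omega> \<le> \<gamma> * (\<Sum>i<n. \<kappa> + log_min (period i \<omega>))"
      using g by (intro mult_left_mono_neg) auto
    then have "ennreal (exp (\<gamma> * log_wealth \<pi> W n \<omega>)) \<le>
        ennreal (exp (\<gamma> * (\<Sum>i<n. \<kappa> + log_min (period i \<omega>))))"
      by (intro ennreal_leI) simp
    also have "\<dots> = (\<Prod>i<n. \<Phi> (W (tau \<eta> i \<omega>) \<omega>) (period i \<omega>))"
      by (simp add: \<Phi>_def sum_distrib_left exp_sum prod_ennreal distrib_left exp_add)
    finally show ?thesis .
  qed
  have "integrable return_measure (\<lambda>y. exp (\<gamma> * \<kappa>) * exp (\<gamma> * log_min y))"
    using R.exp_log_min[OF g] by simp
  then have fin: "(\<integral>\<^sup>+y. \<Phi> w y \<partial>return_measure) =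
      ennreal (\<integral>y. exp (\<gamma> * \<kappa>) * exp (\<gamma> * log_min y) \<partial>return_measure)" for w
    unfolding \<Phi>_def by (intro nn_integral_eq_integral) auto
  have meas: "(\<lambda>(w, y). \<Phi> w y) \<in> borel_measurable (borel \<Otimes>\<^sub>M borel)"
    unfolding \<Phi>_def by measurable
  have "(\<integral>\<^sup>+\<omega>. ennreal (exp (\<gamma> * log_wealth \<pi> W n \<omega>)) \<partial>M) \<le>
      (\<integral>\<^sup>+\<omega>. (\<Prod>i<n. \<Phi> (W (tau \<eta> i \<omega>) \<omega>) (period i \<omega>)) \<partial>M)"
    using le by (rule nn_integral_mono)
  also have "\<dots> \<le> ennreal (\<integral>y. exp (\<gamma> * \<kappa>) * exp (\<gamma> * log_min y) \<partial>return_measure) ^ n"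
    by (rule adapted_product_bounds(2)[OF W meas, of 0]) (simp_all add: fin)
  also have "\<dots> < \<infinity>" by (simp add: power_less_top_ennreal)
  finally show "(\<integral>\<^sup>+\<omega>. ennreal (exp (\<gamma> * log_wealth \<pi> W n \<omega>)) \<partial>M) < \<infinity>" .
qed (simp_all add: borel_measurable_exp)

text \<open>
  For negative \<open>\<gamma>\<close> an upper bound on log wealth is a lower bound on its exponential moment. The surprises
  drop out since their joint exponential moment is at least one; this is a form of Jensen's inequality.
\<close>

lemma exp_log_wealth_ge:
  assumes g: "\<gamma> < 0"
  shows "exp (\<gamma> * (2 * V + real n * (l * mean_wait))) \<le> (\<integral>\<omega>. exp (\<gamma> * log_wealth \<pi> W n \<omega>) \<partial>M)"
proof -
  let ?C = "exp (\<gamma> * (2 * V + real n * (l * mean_wait)))"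
  have [measurable]: "total_surprise W n \<in> borel_measurable M"
    unfolding total_surprise_def[abs_def]
    by (intro borel_measurable_sum R.surprise_measurable weights_measurable period_measurable)
  have "ennreal ?C \<le> ennreal ?C * (\<integral>\<^sup>+\<omega>. ennreal (exp (\<gamma> * total_surprise W n \<omega>)) \<partial>M)"
    using mult_left_mono[OF exp_total_surprise_bounds(1)[OF g, of n], of "ennreal ?C"] by simp
  also have "\<dots> = (\<integral>\<^sup>+\<omega>. ennreal (?C * exp (\<gamma> * total_surprise W n \<omega>)) \<partial>M)"
    by (subst nn_integral_cmult[symmetric]) (simp_all add: ennreal_mult')
  also have "\<dots> \<le> (\<integral>\<^sup>+\<omega>. ennreal (exp (\<gamma> * log_wealth \<pi> W n \<omega>)) \<partial>M)"
  proof (intro nn_integral_mono ennreal_leI)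
    fix \<omega> assume "\<omega> \<in> space M"
    then have "\<gamma> * (2 * V + real n * (l * mean_wait) + total_surprise W n \<omega>) \<le>
        \<gamma> * log_wealth \<pi> W n \<omega>"
      using g by (intro mult_left_mono_neg log_wealth_le) auto
    then show "?C * exp (\<gamma> * total_surprise W n \<omega>) \<le> exp (\<gamma> * log_wealth \<pi> W n \<omega>)"
      by (simp add: distrib_left flip: exp_add)
  qed
  also have "\<dots> = ennreal (\<integral>\<omega>. exp (\<gamma> * log_wealth \<pi> W n \<omega>) \<partial>M)"
    using integrable_exp_log_wealth[OF g] by (intro nn_integral_eq_integral) auto
  finally show ?thesis by (simp add: ennreal_le_iff)
qed

lemma exp_log_wealth_bellman_le:
  assumes g: "\<gamma> < 0" and opt: "bellman_strategy M S \<eta> \<G> c h v l \<pi> W"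
  shows "(\<integral>\<omega>. exp (\<gamma> * log_wealth \<pi> W n \<omega>) \<partial>M) \<le>
    exp (\<gamma> * (- 2 * V + real n * (l * mean_wait))) * (1 + R.risk \<gamma>) ^ n"
proof -
  let ?C = "exp (\<gamma> * (- 2 * V + real n * (l * mean_wait)))"
  have [measurable]: "total_surprise W n \<in> borel_measurable M"
    unfolding total_surprise_def[abs_def]
    by (intro borel_measurable_sum R.surprise_measurable weights_measurable period_measurable)
  have "ennreal (\<integral>\<omega>. exp (\<gamma> * log_wealth \<pi> W n \<omega>) \<partial>M) =
      (\<integral>\<^sup>+\<omega>. ennreal (exp (\<gamma> * log_wealth \<pi> W n \<omega>)) \<partial>M)"
    using integrable_exp_log_wealth[OF g] by (intro nn_integral_eq_integral[symmetric]) auto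
  also have "\<dots> \<le> (\<integral>\<^sup>+\<omega>. ennreal (?C * exp (\<gamma> * total_surprise W n \<omega>)) \<partial>M)"
  proof (intro nn_integral_mono ennreal_leI)
    fix \<omega> assume "\<omega> \<in> space M"
    then have "\<gamma> * log_wealth \<pi> W n \<omega> \<le>
        \<gamma> * (- 2 * V + real n * (l * mean_wait) + total_surprise W n \<omega>)"
      using g by (intro mult_left_mono_neg log_wealth_bellman_ge opt) auto
    then show "exp (\<gamma> * log_wealth \<pi> W n \<omega>) \<le> ?C * exp (\<gamma> * total_surprise W n \<omega>)"
      by (simp add: distrib_left flip: exp_add)
  qed
  also have "\<dots> = ennreal ?C * (\<integral>\<^sup>+\<omega>. ennreal (exp (\<gamma> * total_surprise W n \<omega>)) \<partial>M)"
    by (subst nn_integral_cmult[symmetric]) (simp_all add: ennreal_mult')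
  also have "\<dots> \<le> ennreal ?C * ennreal (1 + R.risk \<gamma>) ^ n"
    by (intro mult_left_mono exp_total_surprise_bounds g) simp
  also have "\<dots> = ennreal (?C * (1 + R.risk \<gamma>) ^ n)"
    using R.risk_nonneg[of \<gamma>]
    by (subst ennreal_power) (simp_all only: ennreal_mult' exp_ge_zero add_nonneg_nonneg zero_le_one)
  finally show ?thesis
    using R.risk_nonneg[of \<gamma>] by (subst (asm) ennreal_le_iff) auto
qed

lemma growth_eq:
  "growth M S \<eta> c h \<gamma> W \<pi> =
    liminf (\<lambda>n. ereal (1 / (real n * mean_wait) * entropic M \<gamma> (log_wealth \<pi> W n)))"
  unfolding growth_def mean_tau log_wealth_def ..

text \<open>
  No strategy grows faster than \<open>l\<close>, however small the risk aversion: the boundary term \<open>2 * V\<close> disappears in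
  the time average.
\<close>

lemma growth_le:
  assumes g: "\<gamma> < 0"
  shows "growth M S \<eta> c h \<gamma> W \<pi> \<le> ereal l"
proof -
  have "entropic M \<gamma> (log_wealth \<pi> W n) \<le> 2 * V + real n * (l * mean_wait)" for n
  proof -
    have "\<gamma> * (2 * V + real n * (l * mean_wait)) \<le> ln (\<integral>\<omega>. exp (\<gamma> * log_wealth \<pi> W n \<omega>) \<partial>M)"
      using exp_log_wealth_ge[OF g, of n] by (subst ln_ge_iff) (auto intro: less_le_trans[OF exp_gt_zero])
    then show ?thesis using g by (simp add: entropic_def field_simps)
  qed
  then have bound: "1 / (real n * mean_wait) * entropic M \<gamma> (log_wealth \<pi> W n) \<le>
      2 * V / mean_wait * (1 / real n) + l" if "0 < n" for n
  proof -
    have "1 / (real n * mean_wait) * entropic M \<gamma> (log_wealth \<pi> W n) \<le>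
        1 / (real n * mean_wait) * (2 * V + real n * (l * mean_wait))"
      using mean_wait_pos by (intro mult_left_mono \<open>\<And>n. entropic M \<gamma> (log_wealth \<pi> W n) \<le> _ n\<close>) auto
    also have "\<dots> = 2 * V / mean_wait * (1 / real n) + l"
      using mean_wait_pos that by (simp add: field_simps)
    finally show ?thesis .
  qed
  have "(\<lambda>n. 2 * V / mean_wait * (1 / real n) + l) \<longlonglongrightarrow> 2 * V / mean_wait * 0 + l"
    by (intro tendsto_intros lim_1_over_n)
  then have "(\<lambda>n. ereal (2 * V / mean_wait * (1 / real n) + l)) \<longlonglongrightarrow> ereal l"
    by (simp add: lim_ereal)
  then have "liminf (\<lambda>n. ereal (2 * V / mean_wait * (1 / real n) + l)) = ereal l"
    by (intro lim_imp_Liminf) auto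
  moreover have "growth M S \<eta> c h \<gamma> W \<pi> \<le> liminf (\<lambda>n. ereal (2 * V / mean_wait * (1 / real n) + l))"
    unfolding growth_eq
    by (intro Liminf_mono eventually_mono[OF eventually_gt_at_top[of 0]]) (simp only: ereal_less_eq bound)
  ultimately show ?thesis by simp
qed

text \<open>
  Following the Bellman equation costs at most the exponential moment of the surprises, that is, a factor
  \<open>1 + risk \<gamma>\<close> per period.
\<close>

lemma growth_bellman_ge:
  assumes g: "\<gamma> < 0" and opt: "bellman_strategy M S \<eta> \<G> c h v l \<pi> W"
  shows "ereal (l + R.risk \<gamma> / \<gamma> / mean_wait) \<le> growth M S \<eta> c h \<gamma> W \<pi>"
proof -
  let ?q = "l + R.risk \<gamma> / \<gamma> / mean_wait"
  have ent: "- 2 * V + real n * (l * mean_wait) + real n * (R.risk \<gamma> / \<gamma>) \<le>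
      entropic M \<gamma> (log_wealth \<pi> W n)" for n
  proof -
    let ?I = "\<integral>\<omega>. exp (\<gamma> * log_wealth \<pi> W n \<omega>) \<partial>M"
    have I: "0 < ?I" using exp_log_wealth_ge[OF g, of n] by (auto intro: less_le_trans[OF exp_gt_zero])
    have r: "0 < 1 + R.risk \<gamma>" using R.risk_nonneg[of \<gamma>] by linarith
    have "ln ?I \<le> ln (exp (\<gamma> * (- 2 * V + real n * (l * mean_wait))) * (1 + R.risk \<gamma>) ^ n)"
      using I r exp_log_wealth_bellman_le[OF g opt, of n] by (subst ln_le_cancel_iff) auto
    also have "\<dots> = \<gamma> * (- 2 * V + real n * (l * mean_wait)) + real n * ln (1 + R.risk \<gamma>)"
      using r by (simp add: ln_mult ln_realpow)
    also have "\<dots> \<le> \<gamma> * (- 2 * V + real n * (l * mean_wait)) + real n * R.risk \<gamma>"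
      using R.risk_nonneg[of \<gamma>] by (intro add_left_mono mult_left_mono ln_add_one_self_le_self) auto
    also have "\<dots> = \<gamma> * (- 2 * V + real n * (l * mean_wait) + real n * (R.risk \<gamma> / \<gamma>))"
      using g by (simp add: distrib_left)
    finally show ?thesis using g by (simp add: entropic_def field_simps)
  qed
  have bound: "- 2 * V / mean_wait * (1 / real n) + ?q \<le>
      1 / (real n * mean_wait) * entropic M \<gamma> (log_wealth \<pi> W n)" if "0 < n" for n
  proof -
    have "- 2 * V / mean_wait * (1 / real n) + ?q =
        1 / (real n * mean_wait) * (- 2 * V + real n * (l * mean_wait) + real n * (R.risk \<gamma> / \<gamma>))"
      using mean_wait_pos that g by (simp add: field_simps)
    also have "\<dots> \<le> 1 / (real n * mean_wait) * entropic M \<gamma> (log_wealth \<pi> W n)"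
      using mean_wait_pos by (intro mult_left_mono ent) auto
    finally show ?thesis .
  qed
  have "(\<lambda>n. - 2 * V / mean_wait * (1 / real n) + ?q) \<longlonglongrightarrow> - 2 * V / mean_wait * 0 + ?q"
    by (intro tendsto_add tendsto_mult tendsto_const lim_1_over_n)
  then have "(\<lambda>n. ereal (- 2 * V / mean_wait * (1 / real n) + ?q)) \<longlonglongrightarrow> ereal ?q"
    by (simp add: lim_ereal)
  then have "liminf (\<lambda>n. ereal (- 2 * V / mean_wait * (1 / real n) + ?q)) = ereal ?q"
    by (intro lim_imp_Liminf) auto
  moreover have "liminf (\<lambda>n. ereal (- 2 * V / mean_wait * (1 / real n) + ?q)) \<le> growth M S \<eta> c h \<gamma> W \<pi>"
    unfolding growth_eq
    by (intro Liminf_mono eventually_mono[OF eventually_gt_at_top[of 0]]) (simp only: ereal_less_eq bound)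
  ultimately show ?thesis by simp
qed

end

end

section \<open>Near-optimality for small risk aversion\<close>

theorem theorem4p4:
  fixes M :: "'w measure"
    and S :: "real \<Rightarrow> 'w \<Rightarrow> real ^ 'd"
    and \<eta> :: "nat \<Rightarrow> 'w \<Rightarrow> real"
    and \<G> :: "nat \<Rightarrow> 'w measure"
    and c h :: "real ^ 'd"
    and v :: "real ^ 'd \<Rightarrow> real"
    and l :: real
    and opt :: "real ^ 'd \<Rightarrow> real \<Rightarrow> 'w \<Rightarrow> real ^ 'd"
  assumes "cost_rates c" and "cost_rates h"
    and "market M S \<eta>"
    and "increments M S"
    and "waiting_times M \<eta>"
    and "integrability M S \<eta>"
    and "information M S \<eta> \<G>"
    and "bellman_solution M S \<eta> c h v l"
    and "\<And>\<pi>. \<pi> \<in> unit_simplex \<Longrightarrow> bellman_strategy M S \<eta> \<G> c h v l \<pi> (opt \<pi>)"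
  shows "((\<lambda>\<gamma>. SUP \<pi>\<in>unit_simplex.
            \<bar>growth M S \<eta> c h \<gamma> (opt \<pi>) \<pi> -
             (SUP W\<in>strategies M S \<eta> \<G> \<pi>. growth M S \<eta> c h \<gamma> W \<pi>)\<bar>)
          \<longlongrightarrow> 0) (at_left 0)"
proof -
  obtain V where V: "\<And>\<pi>. \<pi> \<in> unit_simplex \<Longrightarrow> \<bar>v \<pi>\<bar> \<le> V"
    using assms(8) by (auto simp: bellman_solution_def bounded_iff)
  interpret prob_space M using assms(3) by (simp add: market_def)
  interpret bellman_market M S \<eta> \<G> c h v l V
    by unfold_locales (use assms V in auto)
  let ?e = "\<lambda>\<gamma>. - (R.risk \<gamma> / \<gamma>) / mean_wait"
  let ?J = "\<lambda>\<gamma> W \<pi>. growth M S \<eta> c h \<gamma> W \<pi>"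
  let ?D = "\<lambda>\<gamma> \<pi>. \<bar>?J \<gamma> (opt \<pi>) \<pi> - (SUP W\<in>strategies M S \<eta> \<G> \<pi>. ?J \<gamma> W \<pi>)\<bar>"
  have D: "?D \<gamma> \<pi> \<le> ereal (?e \<gamma>)" if g: "\<gamma> < 0" and pi: "\<pi> \<in> unit_simplex" for \<gamma> \<pi>
  proof -
    let ?s = "SUP W\<in>strategies M S \<eta> \<G> \<pi>. ?J \<gamma> W \<pi>"
    \<comment> \<open>both terms lie between \<open>l - ?e \<gamma>\<close> and \<open>l\<close>\<close>
    have opt: "opt \<pi> \<in> strategies M S \<eta> \<G> \<pi>"
      using assms(9)[OF pi] by (simp add: bellman_strategy_def)
    have lo: "ereal (l + R.risk \<gamma> / \<gamma> / mean_wait) \<le> ?J \<gamma> (opt \<pi>) \<pi>"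
      by (rule growth_bellman_ge[OF pi opt g assms(9)[OF pi]])
    have mid: "?J \<gamma> (opt \<pi>) \<pi> \<le> ?s" by (rule SUP_upper[OF opt])
    have hi: "?s \<le> ereal l" by (intro SUP_least growth_le pi g)
    obtain a where a: "?J \<gamma> (opt \<pi>) \<pi> = ereal a"
      using lo order_trans[OF mid hi] by (cases "?J \<gamma> (opt \<pi>) \<pi>") auto
    obtain b where b: "?s = ereal b"
      using order_trans[OF lo mid] hi by (cases ?s) auto
    show ?thesis using lo mid hi unfolding a b by simp
  qed
  have nonneg: "0 \<le> (SUP \<pi>\<in>unit_simplex. ?D \<gamma> \<pi>)" for \<gamma>
  proof -
    obtain \<pi> :: "real ^ 'd" where "\<pi> \<in> unit_simplex" using unit_simplex_nonempty by blast
    then have "?D \<gamma> \<pi> \<le> (SUP \<pi>\<in>unit_simplex. ?D \<gamma> \<pi>)" by (rule SUP_upper)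
    moreover have "0 \<le> \<bar>x\<bar>" for x :: ereal by (cases x) auto
    ultimately show ?thesis by (rule order_trans[rotated])
  qed
  show ?thesis
  proof (rule tendsto_sandwich[of "\<lambda>_. 0" _ _ "\<lambda>\<gamma>. ereal (?e \<gamma>)"])
    show "\<forall>\<^sub>F \<gamma> in at_left 0. 0 \<le> (SUP \<pi>\<in>unit_simplex. ?D \<gamma> \<pi>)"
      using nonneg by simp
    show "\<forall>\<^sub>F \<gamma> in at_left 0. (SUP \<pi>\<in>unit_simplex. ?D \<gamma> \<pi>) \<le> ereal (?e \<gamma>)"
      unfolding eventually_at_filter by (intro always_eventually allI impI SUP_least D) auto
    have "((\<lambda>\<gamma>. - (R.risk \<gamma> / \<gamma>) / mean_wait) \<longlongrightarrow> - 0 / mean_wait) (at_left 0)"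
      using mean_wait_pos by (intro tendsto_divide tendsto_minus tendsto_const R.risk_div_tendsto) auto
    then show "((\<lambda>\<gamma>. ereal (?e \<gamma>)) \<longlongrightarrow> 0) (at_left 0)"
      unfolding zero_ereal_def by (intro tendsto_ereal) simp
  qed simp
qed

end
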